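(* Let $\mathbf{A}\in\mathbb{R}^{m\times n}$ with $m\le n$, let $l\le s$ be positive integers, and let $\mathbf{\Omega}\in\mathbb{R}^{l\times n}$, $\mathbf{\Gamma}\in\mathbb{R}^{l\times m}$, $\mathbf{\Phi}\in\mathbb{R}^{s\times m}$, $\mathbf{\Psi}\in\mathbb{R}^{s\times n}$ be random sketching matrices. Let $0<\delta<1$ and $0\le\varepsilon\le\frac29$, and assume that $\mathbf{\Phi}$ and $\mathbf{\Psi}$ satisfy both the $(\varepsilon,\delta,l)$ OSE and the $(\varepsilon,\frac{\delta}{n},1)$ OSE properties. Let $Q=\mathrm{range}(\mathbf{A}\mathbf{\Omega}^{\mathrm T})$, $P=\mathrm{range}(\mathbf{A}^{\mathrm T}\mathbf{\Gamma}^{\mathrm T})$, let $\mathbf{\Pi}_Q$, $\mathbf{\Pi}_P$ be the orthogonal projectors onto $Q$ and $P$, and let $[\![\mathbf{A}]\!]^{(\mathrm{sRSVD})}$ be the single-view approximation of $\mathbf{A}$ associated with $\mathbf{\Omega},\mathbf{\Gamma},\mathbf{\Phi},\mathbf{\Psi}$. Then, with probability at least $1-4\delta$, $$\|\mathbf{A}-[\![\mathbf{A}]\!]^{(\mathrm{sRSVD})}\|_{\mathrm F}\;\le\;4.2\,\|\mathbf{A}-\mathbf{\Pi}_Q\mathbf{A}\mathbf{\Pi}_P\|_{\mathrm F}\;\le\;4.2\left(\|\mathbf{A}-\mathbf{\Pi}_Q\mathbf{A}\|_{\mathrm F}+\|\mathbf{A}-\mathbf{A}\mathbf{\Pi}_P\|_{\mathrm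 F}\right).$$
   Context: OSE: for $0\le\varepsilon<1$ and $0<\delta<1$, a random matrix $\mathbf{\Theta}\in\mathbb{R}^{l\times n}$ is an $(\varepsilon,\delta,d)$ oblivious $\ell_2$-subspace embedding (OSE) if for any fixed $d$-dimensional subspace $V\subseteq\mathbb{R}^n$, with probability at least $1-\delta$ it holds that for all $\mathbf{x}\in V$, $\left|\,\|\mathbf{x}\|_2^2-\|\mathbf{\Theta}\mathbf{x}\|_2^2\right|\le\varepsilon\|\mathbf{x}\|_2^2$ (with the dimensions $l$, $n$ replaced by those of the matrix under consideration). Single-view approximation: with $Q=\mathrm{range}(\mathbf{A}\mathbf{\Omega}^{\mathrm T})$ and $P=\mathrm{range}(\mathbf{A}^{\mathrm T}\mathbf{\Gamma}^{\mathrm T})$, $$[\![\mathbf{A}]\!]^{(\mathrm{sRSVD})}=\arg\min_{\mathrm{range}(\mathbf{B})\subseteq Q,\ \mathrm{range}(\mathbf{B}^{\mathrm T})\subseteq P}\|\mathbf{\Phi}(\mathbf{A}-\mathbf{B})\mathbf{\Psi}^{\mathrm T}\|_{\xi},$$ where $\|\cdot\|_\xi$ with $\xi=2,*,\mathrm F$ denotes the spectral, trace or Frobenius norm; it is given explicitly by $[\![\mathbf{A}]\!]^{(\mathrm{sRSVD})}=\mathbf{Q}(\mathbf{\Phi}\mathbf{Q})^{\dagger}(\mathbf{\Phi}\mathbf{A}\mathbf{\Psi}^{\mathrm T})\left((\mathbf{\Psi}\mathbf{P})^{\dagger}\right)^{\mathrm T}\mathbf{P}^{\mathrm T}$, where $\mathbf{Q}$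 and $\mathbf{P}$ are matrices whose columns form orthonormal bases of $Q$ and $P$, and $\dagger$ denotes the pseudo-inverse.
   Formalization: The random sketching matrices are assumed independent in the sense that the pair (Ω,Γ), Φ and Ψ are mutually independent (the claim fails otherwise); when l exceeds the ambient dimension, the (ε,δ,l) OSE property is required of the whole space rather than being vacuous. *)

theory Defs
  imports "HOL-Probability.Probability"
begin

section \<open>Matrices: Frobenius norm, range, orthogonal projectors, pseudo-inverse\<close>

definition frobenius_norm :: "real^'n^'m \<Rightarrow> real" where
  "frobenius_norm A = sqrt (\<Sum>i\<in>UNIV. \<Sum>j\<in>UNIV. (A $ i $ j)\<^sup>2)"

lemma frobenius_norm_eq_norm: "frobenius_norm A = norm A"
  by (simp add: frobenius_norm_def norm_vec_def L2_set_def sum_nonneg)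

definition mat_range :: "real^'n^'m \<Rightarrow> (real^'m) set" where
  "mat_range A = range (\<lambda>x. A *v x)"

definition is_orth_proj :: "real^'n^'n \<Rightarrow> (real^'n) set \<Rightarrow> bool" where
  "is_orth_proj R S \<longleftrightarrow> (\<forall>x. R *v x \<in> S \<and> (\<forall>y\<in>S. orthogonal (x - R *v x) y))"

definition orth_proj :: "(real^'n) set \<Rightarrow> real^'n^'n" where
  "orth_proj S = (THE R. is_orth_proj R S)"

text \<open>The four Moore--Penrose equations.\<close>

definition is_pinv :: "real^'n^'m \<Rightarrow> real^'m^'n \<Rightarrow> bool" where
  "is_pinv A X \<longleftrightarrow> A ** X ** A = A \<and> X ** A ** X = X \<and>
     transpose (A ** X) = A ** X \<and> transpose (X ** A) = X ** A"

definition pinv :: "real^'n^'m \<Rightarrow> real^'m^'n" where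
  "pinv A = (THE X. is_pinv A X)"

text \<open>
  An orthonormal basis of S has dim S elements, and in the application S is random, so this
  number cannot be the column index type. The basis is therefore stored in the nonzero columns,
  and any remaining columns are zero. Zero columns affect neither the product of Q with the
  pseudo-inverse of F ** Q nor any other expression below: they only add zero rows to that
  pseudo-inverse, which meet the zero columns of Q.
\<close>

definition is_onb_matrix :: "real^'k^'n \<Rightarrow> (real^'n) set \<Rightarrow> bool" where
  "is_onb_matrix Q S \<longleftrightarrow>
     (\<forall>j. column j Q = 0 \<or> norm (column j Q) = 1) \<and>
     (\<forall>i j. i \<noteq> j \<longrightarrow> orthogonal (column i Q) (column j Q)) \<and>
     span (columns Q) = S"

section \<open>Single-view approximation\<close>

definition single_view ::
  "real^'n^'m \<Rightarrow> real^'n^'l \<Rightarrow> real^'m^'l \<Rightarrow> real^'m^'s \<Rightarrow> real^'n^'s \<Rightarrow> real^'n^'m" where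
  "single_view A \<Omega> \<Gamma> \<Phi> \<Psi> =
     (let Q = (SOME Q :: real^'l^'m. is_onb_matrix Q (mat_range (A ** transpose \<Omega>)));
          P = (SOME P :: real^'l^'n. is_onb_matrix P (mat_range (transpose A ** transpose \<Gamma>)))
      in Q ** pinv (\<Phi> ** Q) ** (\<Phi> ** A ** transpose \<Psi>) ** transpose (pinv (\<Psi> ** P)) ** transpose P)"

section \<open>Oblivious subspace embeddings and independence of the sketching matrices\<close>

text \<open>
  Subspaces of dimension d exist only for d at most the dimension n of the ambient space; for
  larger d the whole space is to be embedded, so that the property is never vacuous.
\<close>

definition OSE :: "'w measure \<Rightarrow> ('w \<Rightarrow> real^'n^'l) \<Rightarrow> real \<Rightarrow> real \<Rightarrow> nat \<Rightarrow> bool" where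
  "OSE M \<Theta> \<epsilon> \<delta> d \<longleftrightarrow>
     \<Theta> \<in> borel_measurable M \<and> 0 \<le> \<epsilon> \<and> \<epsilon> < 1 \<and> 0 < \<delta> \<and> \<delta> < 1 \<and>
     (\<forall>V :: (real^'n) set. subspace V \<and> dim V = min d CARD('n) \<longrightarrow>
        \<P>(\<omega> in M. \<forall>x\<in>V. \<bar>(norm x)\<^sup>2 - (norm (\<Theta> \<omega> *v x))\<^sup>2\<bar> \<le> \<epsilon> * (norm x)\<^sup>2) \<ge> 1 - \<delta>)"

definition generated_events ::
  "'w measure \<Rightarrow> ('w \<Rightarrow> 'b::topological_space) \<Rightarrow> 'w set set" where
  "generated_events M X = {X -` B \<inter> space M | B. B \<in> sets borel}"

text \<open>
  Mutual independence of three random variables with different codomains; the library's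
  \<open>indep_vars\<close> wants a common codomain type.
\<close>

definition indep_vars3 :: "'w measure \<Rightarrow> ('w \<Rightarrow> 'a::topological_space) \<Rightarrow>
    ('w \<Rightarrow> 'b::topological_space) \<Rightarrow> ('w \<Rightarrow> 'c::topological_space) \<Rightarrow> bool" where
  "indep_vars3 M X Y Z \<longleftrightarrow>
     prob_space.indep_sets M
       (\<lambda>i. [generated_events M X, generated_events M Y, generated_events M Z] ! i) {0, 1, 2}"

section \<open>Well-definedness\<close>

lemma adjoint_transpose: "(A *v x) \<bullet> y = x \<bullet> (transpose A *v y)" for A :: "real^'n^'m"
  by (metis dot_lmul_matrix transpose_matrix_vector transpose_transpose)

lemma matrix_eqI_vec: "(\<And>x. A *v x = B *v x) \<Longrightarrow> A = B" for A B :: "real^'n^'m"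
  by (simp add: matrix_eq)

lemma is_orth_proj_unique:
  assumes "subspace S" "is_orth_proj X S" "is_orth_proj Y S"
  shows "X = Y"
proof (rule matrix_eqI_vec)
  fix x
  let ?d = "X *v x - Y *v x"
  have d: "?d \<in> S" using assms by (simp add: is_orth_proj_def subspace_diff)
  have "(x - X *v x) \<bullet> ?d = 0" "(x - Y *v x) \<bullet> ?d = 0"
    using assms d by (auto simp: is_orth_proj_def orthogonal_def)
  then have "?d \<bullet> ?d = 0" by (simp add: inner_diff_left)
  then show "X *v x = Y *v x" by simp
qed

lemma is_orth_proj_exists:
  assumes "subspace S"
  shows "\<exists>X. is_orth_proj X S"
proof -
  have "\<exists>y. y \<in> S \<and> (\<forall>w\<in>S. orthogonal (x - y) w)" for x
    using orthogonal_subspace_decomp_exists[of S x] assms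
    by (metis add_diff_cancel_left' span_eq_iff)
  then obtain f where f: "\<And>x. f x \<in> S" "\<And>x w. w \<in> S \<Longrightarrow> orthogonal (x - f x) w"
    by metis
  have uniq: "y = f x" if "y \<in> S" "\<And>w. w \<in> S \<Longrightarrow> orthogonal (x - y) w" for x y
  proof -
    have d: "y - f x \<in> S" using that f assms by (simp add: subspace_diff)
    have "(x - y) \<bullet> (y - f x) = 0" "(x - f x) \<bullet> (y - f x) = 0"
      using that(2)[OF d] f(2)[OF d] by (auto simp: orthogonal_def)
    then have "(y - f x) \<bullet> (y - f x) = 0" by (simp add: inner_diff_left)
    then show ?thesis by simp
  qed
  have "linear f"
  proof (rule linearI)
    fix x y show "f (x + y) = f x + f y"
    proof (rule uniq[symmetric])
      show "f x + f y \<in> S" using f assms by (simp add: subspace_add)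
      fix w assume "w \<in> S"
      then have "(x - f x) \<bullet> w = 0" "(y - f y) \<bullet> w = 0" using f by (auto simp: orthogonal_def)
      then show "orthogonal (x + y - (f x + f y)) w"
        by (simp add: orthogonal_def inner_diff_left inner_add_left)
    qed
  next
    fix c x show "f (c *\<^sub>R x) = c *\<^sub>R f x"
    proof (rule uniq[symmetric])
      show "c *\<^sub>R f x \<in> S" using f assms by (simp add: subspace_scale)
      fix w assume "w \<in> S"
      then have "(x - f x) \<bullet> w = 0" using f by (auto simp: orthogonal_def)
      then show "orthogonal (c *\<^sub>R x - c *\<^sub>R f x) w"
        by (simp add: orthogonal_def inner_diff_left)
    qed
  qed
  then have "is_orth_proj (matrix f) S"
    using f by (simp add: is_orth_proj_def)
  then show ?thesis ..
qed

lemma orth_proj: "subspace S \<Longrightarrow> is_orth_proj (orth_proj S) S"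
  unfolding orth_proj_def
  by (rule theI', rule ex_ex1I[OF is_orth_proj_exists is_orth_proj_unique])

lemma subspace_mat_range: "subspace (mat_range A)" for A :: "real^'n^'m"
  unfolding mat_range_def by (simp add: linear_subspace_image)

lemma is_orth_proj_fix:
  assumes "subspace S" "is_orth_proj X S" "y \<in> S"
  shows "X *v y = y"
proof -
  have d: "y - X *v y \<in> S" using assms by (simp add: is_orth_proj_def subspace_diff)
  have "(y - X *v y) \<bullet> (y - X *v y) = 0"
    using assms d by (auto simp: is_orth_proj_def orthogonal_def)
  then show ?thesis by simp
qed

lemma is_orth_proj_sym:
  assumes "is_orth_proj X S"
  shows "transpose X = X"
proof (rule matrix_eqI_vec)
  fix y
  have "x \<bullet> (transpose X *v y) = x \<bullet> (X *v y)" for x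
  proof -
    have *: "(u - X *v u) \<bullet> (X *v w) = 0" for u w
      using assms by (simp add: is_orth_proj_def orthogonal_def)
    have "x \<bullet> (transpose X *v y) = (X *v x) \<bullet> y" by (rule adjoint_transpose[symmetric])
    also have "\<dots> = (X *v x) \<bullet> (X *v y)"
      using *[of y x] by (subst (asm) inner_commute) (simp add: inner_diff_right)
    also have "\<dots> = x \<bullet> (X *v y)"
      using *[of x y] by (simp add: inner_diff_left)
    finally show ?thesis .
  qed
  then show "transpose X *v y = X *v y"
    by (metis vector_eq_ldot)
qed

lemma is_pinv_exists: "\<exists>X. is_pinv A X" for A :: "real^'n^'m"
proof -
  define PR where "PR = orth_proj (mat_range A)"
  define PK where "PK = orth_proj (mat_range (transpose A))"
  have PR: "is_orth_proj PR (mat_range A)"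
    unfolding PR_def by (rule orth_proj[OF subspace_mat_range])
  have PK: "is_orth_proj PK (mat_range (transpose A))"
    unfolding PK_def by (rule orth_proj[OF subspace_mat_range])
  obtain g where g: "linear g" "\<forall>v\<in>((*v) A) ` UNIV. A *v (g v) = v"
    using linear_exists_right_inverse_on[of "(*v) A" UNIV] by (auto simp: subspace_UNIV)
  define G where "G = matrix g"
  have G: "A *v (G *v (A *v x)) = A *v x" for x
    using g by (simp add: G_def)
  have PRA: "PR *v (A *v x) = A *v x" for x
    using is_orth_proj_fix[OF subspace_mat_range PR] by (simp add: mat_range_def)
  have ker: "PK *v x = 0" if "A *v x = 0" for x
  proof -
    have "x \<bullet> (PK *v x) = 0"
    proof -
      obtain u where "PK *v x = transpose A *v u"
        using PK by (auto simp: is_orth_proj_def mat_range_def)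
      then show ?thesis using that
        by (simp add: adjoint_transpose[symmetric] del: transpose_matrix_vector)
    qed
    moreover have "(x - PK *v x) \<bullet> (PK *v x) = 0"
      using PK by (auto simp: is_orth_proj_def orthogonal_def)
    ultimately show ?thesis by (simp add: inner_diff_left)
  qed
  have APK: "A *v (PK *v x) = A *v x" for x
  proof -
    have "(A *v (x - PK *v x)) \<bullet> y = 0" for y
      using PK by (simp add: adjoint_transpose is_orth_proj_def orthogonal_def mat_range_def)
    then have "A *v (x - PK *v x) = 0" by (metis inner_eq_zero_iff)
    then show ?thesis by (simp add: matrix_vector_mult_diff_distrib)
  qed
  have PKGA: "PK *v (G *v (A *v x)) = PK *v x" for x
  proof -
    have "PK *v (G *v (A *v x) - x) = 0"
      by (rule ker) (simp add: matrix_vector_mult_diff_distrib G)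
    then show ?thesis by (simp add: matrix_vector_mult_diff_distrib)
  qed
  have AGPR: "A *v (G *v (PR *v x)) = PR *v x" for x
  proof -
    obtain u where "PR *v x = A *v u"
      using PR by (auto simp: is_orth_proj_def mat_range_def)
    then show ?thesis by (simp add: G)
  qed
  have PKPK: "PK *v (PK *v x) = PK *v x" for x
    using PK by (intro is_orth_proj_fix[OF subspace_mat_range PK]) (simp add: is_orth_proj_def)
  define X where "X = PK ** G ** PR"
  have AX: "A ** X = PR"
    by (rule matrix_eqI_vec)
      (simp add: X_def matrix_vector_mul_assoc[symmetric] APK AGPR)
  have XA: "X ** A = PK"
    by (rule matrix_eqI_vec)
      (simp add: X_def matrix_vector_mul_assoc[symmetric] PRA PKGA)
  have "PR ** A = A"
    by (rule matrix_eqI_vec) (simp add: matrix_vector_mul_assoc[symmetric] PRA)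
  moreover have "PK ** X = X"
    by (rule matrix_eqI_vec) (simp add: X_def matrix_vector_mul_assoc[symmetric] PKPK)
  ultimately have "is_pinv A X"
    using is_orth_proj_sym[OF PR] is_orth_proj_sym[OF PK] by (simp add: is_pinv_def AX XA)
  then show ?thesis ..
qed

lemma is_pinv_unique:
  fixes A :: "real^'n^'m"
  assumes "is_pinv A X" and "is_pinv A Y"
  shows "X = Y"
proof -
  have X: "A ** X ** A = A" "X ** A ** X = X"
      "transpose (A ** X) = A ** X" "transpose (X ** A) = X ** A"
    and Y: "A ** Y ** A = A" "Y ** A ** Y = Y"
      "transpose (A ** Y) = A ** Y" "transpose (Y ** A) = Y ** A"
    using assms by (simp_all only: is_pinv_def)
  have "A ** X = A ** Y ** (A ** X)" by (simp only: matrix_mul_assoc Y)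
  from arg_cong[OF this, of transpose] have "A ** X = A ** X ** (A ** Y)"
    by (simp only: matrix_transpose_mul[of "A ** Y" "A ** X"] X Y)
  then have 1: "A ** X = A ** Y" by (simp only: matrix_mul_assoc X)
  have "X ** A = X ** A ** (Y ** A)"
    by (simp only: matrix_mul_assoc[symmetric] Y(1)[unfolded matrix_mul_assoc[symmetric]])
  from arg_cong[OF this, of transpose] have "X ** A = Y ** A ** (X ** A)"
    by (simp only: matrix_transpose_mul[of "X ** A" "Y ** A"] X Y)
  then have 2: "X ** A = Y ** A"
    by (simp only: matrix_mul_assoc[symmetric] X(1)[unfolded matrix_mul_assoc[symmetric]])
  have "X = X ** (A ** X)" by (simp only: matrix_mul_assoc X)
  also have "\<dots> = (X ** A) ** Y" by (simp only: 1 matrix_mul_assoc)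
  also have "\<dots> = Y" by (simp only: 2 Y)
  finally show ?thesis .
qed

lemma is_pinv_pinv: "is_pinv A (pinv A)"
  unfolding pinv_def by (rule theI', rule ex_ex1I[OF is_pinv_exists is_pinv_unique])

lemma pinv_eqI: "is_pinv A X \<Longrightarrow> pinv A = X"
  by (rule is_pinv_unique[OF is_pinv_pinv])

lemma is_onb_matrix_exists:
  fixes S :: "(real^'n) set"
  assumes "subspace S" "dim S \<le> CARD('k)"
  shows "\<exists>Q :: real^'k^'n. is_onb_matrix Q S"
proof -
  obtain B where B: "pairwise orthogonal B" "\<And>x. x \<in> B \<Longrightarrow> norm x = 1"
      "independent B" "card B = dim S" "span B = S"
    using orthonormal_basis_subspace[OF assms(1)] by metis
  have fB: "finite B" using B(3) independent_imp_finite by blast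
  obtain J :: "'k set" where J: "card J = card B"
    using assms(2) B(4) obtain_subset_with_card_n[of "card B" "UNIV :: 'k set"] by auto
  obtain h where h: "bij_betw h J B"
    using J fB by (metis finite bij_betw_iff_card)
  define Q :: "real^'k^'n" where "Q = (\<chi> i j. if j \<in> J then h j $ i else 0)"
  have col: "column j Q = (if j \<in> J then h j else 0)" for j
    by (simp add: column_def Q_def vec_eq_iff)
  have hB: "h j \<in> B" if "j \<in> J" for j using h that by (auto simp: bij_betw_def)
  have "span (columns Q) = S"
  proof
    have "columns Q \<subseteq> insert 0 B" using hB by (auto simp: columns_def col)
    then have "span (columns Q) \<subseteq> span (insert 0 B)" by (rule span_mono)
    then show "span (columns Q) \<subseteq> S" using B by (simp add: span_insert_0)
    have "B \<subseteq> columns Q"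
    proof
      fix b assume "b \<in> B"
      then obtain j where "j \<in> J" "b = h j" using h by (auto simp: bij_betw_def)
      then have "b = column j Q" by (simp add: col)
      then show "b \<in> columns Q" by (auto simp: columns_def)
    qed
    then show "S \<subseteq> span (columns Q)" using B(5) span_mono by blast
  qed
  moreover have "orthogonal (column i Q) (column j Q)" if "i \<noteq> j" for i j
  proof (cases "i \<in> J \<and> j \<in> J")
    case True
    then have "h i \<noteq> h j" using h that by (auto simp: bij_betw_def inj_on_def)
    then show ?thesis using True B(1) hB by (simp add: col pairwise_def)
  qed (auto simp: col orthogonal_def)
  ultimately have "is_onb_matrix Q S"
    using B(2) hB by (auto simp: is_onb_matrix_def col)
  then show ?thesis ..
qed

lemma mat_range_eq_span: "mat_range A = span (columns A)" for A :: "real^'n^'m"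
proof
  show "mat_range A \<subseteq> span (columns A)"
    by (auto simp: mat_range_def matrix_vector_mult_in_columnspace)
  have "columns A \<subseteq> mat_range A"
    by (auto simp: columns_def mat_range_def) (metis matrix_vector_mult_basis rangeI)
  then show "span (columns A) \<subseteq> mat_range A"
    by (rule span_minimal[OF _ subspace_mat_range])
qed

lemma dim_mat_range: "dim (mat_range A) \<le> CARD('n)" for A :: "real^'n^'m"
  unfolding mat_range_def
  using dim_image_le[of "(*v) A" UNIV] by simp

lemma is_onb_matrix_gram:
  assumes "is_onb_matrix Q S"
  shows "Q ** (transpose Q ** Q) = Q"
proof -
  have G: "(transpose Q ** Q) $ i $ j = column i Q \<bullet> column j Q" for i j
    by (simp add: matrix_matrix_mult_def transpose_def inner_vec_def column_def)
  have "(Q ** (transpose Q ** Q)) $ i $ j = Q $ i $ j" for i j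
  proof -
    have "(Q ** (transpose Q ** Q)) $ i $ j = (\<Sum>k\<in>UNIV. Q $ i $ k * (column k Q \<bullet> column j Q))"
      by (subst matrix_matrix_mult_def) (simp add: G)
    also have "\<dots> = (\<Sum>k\<in>UNIV. if k = j then Q $ i $ j * (column j Q \<bullet> column j Q) else 0)"
      using assms by (intro sum.cong) (auto simp: is_onb_matrix_def orthogonal_def)
    also have "\<dots> = Q $ i $ j * (column j Q \<bullet> column j Q)" by simp
    also have "\<dots> = Q $ i $ j"
    proof (cases "column j Q = 0")
      case True
      then have "Q $ i $ j = 0" by (simp add: column_def vec_eq_iff)
      then show ?thesis by simp
    next
      case False
      then have "norm (column j Q) = 1" using assms by (auto simp: is_onb_matrix_def)
      then show ?thesis by (simp add: norm_eq_1)
    qed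
    finally show ?thesis .
  qed
  then show ?thesis by (simp add: vec_eq_iff)
qed

lemma is_onb_matrix_proj:
  assumes "is_onb_matrix Q S"
  shows "is_orth_proj (Q ** transpose Q) S"
proof -
  have S: "S = mat_range Q" using assms by (simp add: mat_range_eq_span is_onb_matrix_def)
  have "(Q ** transpose Q) *v x \<in> S" for x
    by (auto simp: S mat_range_def matrix_vector_mul_assoc[symmetric])
  moreover have "orthogonal (x - (Q ** transpose Q) *v x) (Q *v u)" for x u
  proof -
    have "transpose Q ** (Q ** transpose Q) = transpose Q"
      using arg_cong[OF is_onb_matrix_gram[OF assms], of transpose]
      by (simp add: matrix_transpose_mul matrix_mul_assoc)
    then have "transpose Q *v (x - (Q ** transpose Q) *v x) = 0"
      by (simp add: matrix_vector_mult_diff_distrib matrix_vector_mul_assoc)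
    then show ?thesis
      by (simp add: orthogonal_def inner_commute[of _ "Q *v u"] adjoint_transpose)
  qed
  ultimately show ?thesis by (auto simp: is_orth_proj_def S mat_range_def)
qed

lemma is_onb_matrix_pinv:
  fixes Q :: "real^'k^'n" and F :: "real^'n^'s"
  assumes "is_onb_matrix Q S"
  shows "Q ** pinv (F ** Q) = pinv (F ** orth_proj S)"
proof -
  let ?M = "F ** Q"
  let ?X = "pinv ?M"
  have "subspace S" using assms by (auto simp: is_onb_matrix_def)
  then have R: "orth_proj S = Q ** transpose Q"
    using is_orth_proj_unique orth_proj is_onb_matrix_proj[OF assms] by blast
  have X: "?M ** ?X ** ?M = ?M" "?X ** ?M ** ?X = ?X"
      "transpose (?M ** ?X) = ?M ** ?X" "transpose (?X ** ?M) = ?X ** ?M"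
    using is_pinv_pinv[of ?M] by (auto simp: is_pinv_def)
  have 1: "(F ** orth_proj S) ** (Q ** ?X) = ?M ** ?X"
  proof -
    have "(F ** orth_proj S) ** (Q ** ?X) = F ** (Q ** (transpose Q ** Q)) ** ?X"
      by (simp add: R matrix_mul_assoc)
    then show ?thesis by (simp add: is_onb_matrix_gram[OF assms])
  qed
  have 2: "(Q ** ?X) ** (F ** orth_proj S) = Q ** (?X ** ?M) ** transpose Q"
    by (simp add: R matrix_mul_assoc)
  have "is_pinv (F ** orth_proj S) (Q ** ?X)"
    unfolding is_pinv_def
  proof (intro conjI)
    have "(F ** orth_proj S) ** (Q ** ?X) ** (F ** orth_proj S)
        = (?M ** ?X ** ?M) ** transpose Q"
      unfolding 1 by (simp add: R matrix_mul_assoc)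
    also have "\<dots> = F ** orth_proj S"
      unfolding X(1) by (simp only: R matrix_mul_assoc)
    finally show "(F ** orth_proj S) ** (Q ** ?X) ** (F ** orth_proj S) = F ** orth_proj S" .
    have "(Q ** ?X) ** (F ** orth_proj S) ** (Q ** ?X)
        = (Q ** ?X) ** ((F ** orth_proj S) ** (Q ** ?X))"
      by (simp add: matrix_mul_assoc)
    also have "\<dots> = Q ** (?X ** ?M ** ?X)" unfolding 1 by (simp add: matrix_mul_assoc)
    finally show "(Q ** ?X) ** (F ** orth_proj S) ** (Q ** ?X) = Q ** ?X"
      by (simp only: X)
    show "transpose ((F ** orth_proj S) ** (Q ** ?X)) = (F ** orth_proj S) ** (Q ** ?X)"
      unfolding 1 by (rule X)
    have "transpose (Q ** (?X ** ?M) ** transpose Q)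
        = Q ** (transpose (?X ** ?M) ** transpose Q)"
      by (simp only: matrix_transpose_mul transpose_transpose)
    then show "transpose ((Q ** ?X) ** (F ** orth_proj S)) = (Q ** ?X) ** (F ** orth_proj S)"
      unfolding 2 X by (simp only: matrix_mul_assoc)
  qed
  then show ?thesis using pinv_eqI by metis
qed

text \<open>The single-view approximation does not depend on the choice of the orthonormal bases.\<close>

lemma single_view_eq:
  fixes A :: "real^'n^'m" and \<Omega> :: "real^'n^'l" and \<Gamma> :: "real^'m^'l"
    and Q :: "real^'k^'m" and P :: "real^'j^'n"
  assumes Q: "is_onb_matrix Q (mat_range (A ** transpose \<Omega>))"
    and P: "is_onb_matrix P (mat_range (transpose A ** transpose \<Gamma>))"
  shows "single_view A \<Omega> \<Gamma> \<Phi> \<Psi> =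
    Q ** pinv (\<Phi> ** Q) ** (\<Phi> ** A ** transpose \<Psi>) ** transpose (pinv (\<Psi> ** P)) ** transpose P"
proof -
  define Q' :: "real^'l^'m" where "Q' = (SOME Q. is_onb_matrix Q (mat_range (A ** transpose \<Omega>)))"
  define P' :: "real^'l^'n"
    where "P' = (SOME P. is_onb_matrix P (mat_range (transpose A ** transpose \<Gamma>)))"
  have Q': "is_onb_matrix Q' (mat_range (A ** transpose \<Omega>))"
    unfolding Q'_def
    by (rule someI_ex, rule is_onb_matrix_exists[OF subspace_mat_range dim_mat_range])
  have P': "is_onb_matrix P' (mat_range (transpose A ** transpose \<Gamma>))"
    unfolding P'_def
    by (rule someI_ex, rule is_onb_matrix_exists[OF subspace_mat_range dim_mat_range])
  have 1: "Q' ** pinv (\<Phi> ** Q') = Q ** pinv (\<Phi> ** Q)"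
    by (simp only: is_onb_matrix_pinv[OF Q] is_onb_matrix_pinv[OF Q'])
  have "P' ** pinv (\<Psi> ** P') = P ** pinv (\<Psi> ** P)"
    by (simp only: is_onb_matrix_pinv[OF P] is_onb_matrix_pinv[OF P'])
  from arg_cong[OF this, of transpose]
  have 2: "transpose (pinv (\<Psi> ** P')) ** transpose P' = transpose (pinv (\<Psi> ** P)) ** transpose P"
    by (simp only: matrix_transpose_mul)
  show ?thesis
    unfolding single_view_def Let_def Q'_def[symmetric] P'_def[symmetric] 1
    by (simp only: matrix_mul_assoc[symmetric] 2)
qed

section \<open>The minimisation property\<close>

lemma matrix_diff_ldistrib: "A ** (B - C) = A ** B - A ** C"
  for A :: "real^'n^'m" and B C :: "real^'p^'n"
  by (simp add: vec_eq_iff matrix_matrix_mult_def right_diff_distrib sum_subtractf)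

lemma matrix_diff_rdistrib: "(A - B) ** C = A ** C - B ** C"
  for A B :: "real^'n^'m" and C :: "real^'p^'n"
  by (simp add: vec_eq_iff matrix_matrix_mult_def left_diff_distrib sum_subtractf)

lemma inner_matrix_mult_left: "X \<bullet> (M ** Z) = (transpose M ** X) \<bullet> Z"
  for M :: "real^'k^'s" and X :: "real^'n^'s" and Z :: "real^'n^'k"
proof -
  have "X \<bullet> (M ** Z) = (\<Sum>i\<in>UNIV. \<Sum>j\<in>UNIV. \<Sum>k\<in>UNIV. X $ i $ j * (M $ i $ k * Z $ k $ j))"
    by (simp add: inner_vec_def matrix_matrix_mult_def sum_distrib_left)
  also have "\<dots> = (\<Sum>k\<in>UNIV. \<Sum>j\<in>UNIV. \<Sum>i\<in>UNIV. X $ i $ j * (M $ i $ k * Z $ k $ j))"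
    by (subst sum.swap, subst (2) sum.swap, subst sum.swap) simp
  also have "\<dots> = (transpose M ** X) \<bullet> Z"
    unfolding inner_vec_def matrix_matrix_mult_def transpose_def
    by (simp add: sum_distrib_left mult_ac)
  finally show ?thesis .
qed

lemma inner_transpose: "transpose X \<bullet> transpose Y = X \<bullet> Y" for X Y :: "real^'n^'m"
  by (simp add: inner_vec_def transpose_def) (rule sum.swap)

lemma inner_matrix_mult_right: "X \<bullet> (Z ** transpose N) = (X ** N) \<bullet> Z"
  for N :: "real^'k^'s" and X :: "real^'s^'m" and Z :: "real^'k^'m"
proof -
  have "X \<bullet> (Z ** transpose N) = transpose X \<bullet> (N ** transpose Z)"
    by (subst inner_transpose[symmetric]) (simp add: matrix_transpose_mul)
  also have "\<dots> = (transpose N ** transpose X) \<bullet> transpose Z"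
    by (rule inner_matrix_mult_left)
  also have "\<dots> = (X ** N) \<bullet> Z"
    by (subst (2) inner_transpose[symmetric]) (simp add: matrix_transpose_mul)
  finally show ?thesis .
qed

lemma transpose_pinv_mult: "transpose M ** (M ** pinv M) = transpose M"
proof -
  have "transpose (M ** pinv M ** M) = transpose M ** transpose (M ** pinv M)"
    by (rule matrix_transpose_mul)
  also have "\<dots> = transpose M ** (M ** pinv M)"
    using is_pinv_pinv[of M] by (simp add: is_pinv_def)
  finally have "transpose M ** (M ** pinv M) = transpose (M ** pinv M ** M)" ..
  then show ?thesis using is_pinv_pinv[of M] by (simp add: is_pinv_def)
qed

lemma sandwich_least_squares:
  fixes C :: "real^'t^'s" and M :: "real^'k^'s" and N :: "real^'j^'t" and X :: "real^'j^'k"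
  defines "S \<equiv> pinv M ** C ** transpose (pinv N)"
  shows "(norm (C - M ** X ** transpose N))\<^sup>2 =
    (norm (C - M ** S ** transpose N))\<^sup>2 + (norm (M ** (S - X) ** transpose N))\<^sup>2"
proof -
  let ?R = "C - M ** S ** transpose N"
  let ?D = "M ** (S - X) ** transpose N"
  have N: "transpose (pinv N) ** (transpose N ** N) = N"
    using arg_cong[OF transpose_pinv_mult[of N], of transpose]
    by (simp add: matrix_transpose_mul matrix_mul_assoc)
  have "transpose M ** (M ** S ** transpose N) ** N
      = (transpose M ** (M ** pinv M)) ** C ** (transpose (pinv N) ** (transpose N ** N))"
    by (simp add: S_def matrix_mul_assoc)
  also have "\<dots> = transpose M ** C ** N" by (simp add: transpose_pinv_mult N)
  finally have "transpose M ** ?R ** N = 0"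
    by (simp add: matrix_diff_ldistrib matrix_diff_rdistrib)
  moreover have "?R \<bullet> ?D = (transpose M ** ?R ** N) \<bullet> (S - X)"
    by (simp only: inner_matrix_mult_right[of ?R "M ** (S - X)" N]
        inner_matrix_mult_left[of "?R ** N" M "S - X"] matrix_mul_assoc)
  ultimately have "?R \<bullet> ?D = 0" by simp
  moreover have "C - M ** X ** transpose N = ?R + ?D"
    by (simp add: matrix_diff_ldistrib matrix_diff_rdistrib)
  ultimately show ?thesis
    using norm_add_Pythagorean[of ?R ?D] by (simp only: orthogonal_def)
qed

lemma mat_range_subset_iff:
  assumes "is_onb_matrix Q S"
  shows "mat_range B \<subseteq> S \<longleftrightarrow> Q ** transpose Q ** B = B"
proof
  have S: "subspace S" using assms by (auto simp: is_onb_matrix_def)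
  assume "mat_range B \<subseteq> S"
  then show "Q ** transpose Q ** B = B"
    using is_orth_proj_fix[OF S is_onb_matrix_proj[OF assms]]
    by (intro matrix_eqI_vec) (auto simp: mat_range_def simp flip: matrix_vector_mul_assoc[of _ B])
next
  assume B: "Q ** transpose Q ** B = B"
  have "B *v x \<in> S" for x
    using is_onb_matrix_proj[OF assms] matrix_vector_mul_assoc[of "Q ** transpose Q" B x]
    by (metis B is_orth_proj_def)
  then show "mat_range B \<subseteq> S" by (auto simp: mat_range_def)
qed

text \<open>
  The explicit formula solves the sketched minimisation problem for the Frobenius norm, and it is
  the only solution when the two sketching matrices are injective on the two subspaces.
\<close>

lemma single_view_minimises:
  fixes A B :: "real^'n^'m" and \<Omega> :: "real^'n^'l" and \<Gamma> :: "real^'m^'l"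
    and \<Phi> :: "real^'m^'s" and \<Psi> :: "real^'n^'s"
  defines "SQ \<equiv> mat_range (A ** transpose \<Omega>)"
    and "SP \<equiv> mat_range (transpose A ** transpose \<Gamma>)"
    and "A' \<equiv> single_view A \<Omega> \<Gamma> \<Phi> \<Psi>"
  shows "mat_range A' \<subseteq> SQ" "mat_range (transpose A') \<subseteq> SP"
    and "mat_range B \<subseteq> SQ \<Longrightarrow> mat_range (transpose B) \<subseteq> SP \<Longrightarrow>
      frobenius_norm (\<Phi> ** (A - A') ** transpose \<Psi>) \<le> frobenius_norm (\<Phi> ** (A - B) ** transpose \<Psi>)"
    and "mat_range B \<subseteq> SQ \<Longrightarrow> mat_range (transpose B) \<subseteq> SP \<Longrightarrow>
      inj_on ((*v) \<Phi>) SQ \<Longrightarrow> inj_on ((*v) \<Psi>) SP \<Longrightarrow>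
      frobenius_norm (\<Phi> ** (A - B) ** transpose \<Psi>) \<le> frobenius_norm (\<Phi> ** (A - A') ** transpose \<Psi>) \<Longrightarrow>
      B = A'"
proof -
  obtain Q :: "real^'l^'m" where Q: "is_onb_matrix Q SQ"
    unfolding SQ_def using is_onb_matrix_exists[OF subspace_mat_range dim_mat_range] by blast
  obtain P :: "real^'l^'n" where P: "is_onb_matrix P SP"
    unfolding SP_def using is_onb_matrix_exists[OF subspace_mat_range dim_mat_range] by blast
  define M where "M = \<Phi> ** Q"
  define N where "N = \<Psi> ** P"
  define C where "C = \<Phi> ** A ** transpose \<Psi>"
  define S where "S = pinv M ** C ** transpose (pinv N)"
  have A': "A' = Q ** S ** transpose P"
    unfolding A'_def S_def M_def N_def C_def
    using single_view_eq[OF Q[unfolded SQ_def] P[unfolded SP_def], of \<Phi> \<Psi>]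
    by (simp only: matrix_mul_assoc)
  have QQ: "Q ** transpose Q ** Q = Q"
    using is_onb_matrix_gram[OF Q] by (simp add: matrix_mul_assoc)
  have PP: "P ** transpose P ** P = P"
    using is_onb_matrix_gram[OF P] by (simp add: matrix_mul_assoc)
  show 1: "mat_range A' \<subseteq> SQ"
    unfolding mat_range_subset_iff[OF Q] A' by (simp only: matrix_mul_assoc QQ)
  show 2: "mat_range (transpose A') \<subseteq> SP"
    unfolding mat_range_subset_iff[OF P] A'
    by (simp only: matrix_transpose_mul transpose_transpose matrix_mul_assoc PP)
  have res: "\<Phi> ** (A - Q ** X ** transpose P) ** transpose \<Psi> = C - M ** X ** transpose N" for X
    by (simp only: C_def M_def N_def matrix_diff_ldistrib matrix_diff_rdistrib
        matrix_transpose_mul matrix_mul_assoc)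
  {
    assume B: "mat_range B \<subseteq> SQ" "mat_range (transpose B) \<subseteq> SP"
    define X where "X = transpose Q ** B ** P"
    have "Q ** transpose Q ** B = B"
      by (rule iffD1[OF mat_range_subset_iff[OF Q] B(1)])
    moreover have "B ** (P ** transpose P) = B"
    proof -
      have "P ** transpose P ** transpose B = transpose B"
        by (rule iffD1[OF mat_range_subset_iff[OF P] B(2)])
      from arg_cong[OF this, of transpose] show ?thesis by (simp add: matrix_transpose_mul)
    qed
    ultimately have BX: "B = Q ** X ** transpose P"
      unfolding X_def by (metis matrix_mul_assoc)
    have eq: "(norm (\<Phi> ** (A - B) ** transpose \<Psi>))\<^sup>2 =
        (norm (\<Phi> ** (A - A') ** transpose \<Psi>))\<^sup>2 + (norm (M ** (S - X) ** transpose N))\<^sup>2"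
      unfolding A' BX res S_def by (rule sandwich_least_squares)
    show "frobenius_norm (\<Phi> ** (A - A') ** transpose \<Psi>)
        \<le> frobenius_norm (\<Phi> ** (A - B) ** transpose \<Psi>)"
      unfolding frobenius_norm_eq_norm by (rule power2_le_imp_le) (simp_all add: eq)
    assume inj: "inj_on ((*v) \<Phi>) SQ" "inj_on ((*v) \<Psi>) SP"
      and le: "frobenius_norm (\<Phi> ** (A - B) ** transpose \<Psi>)
        \<le> frobenius_norm (\<Phi> ** (A - A') ** transpose \<Psi>)"
    have "(norm (\<Phi> ** (A - B) ** transpose \<Psi>))\<^sup>2 \<le> (norm (\<Phi> ** (A - A') ** transpose \<Psi>))\<^sup>2"
      using le by (intro power_mono) (simp_all add: frobenius_norm_eq_norm)
    with eq have 0: "M ** (S - X) ** transpose N = 0" by simp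
    define D where "D = A' - B"
    have "\<Phi> ** D ** transpose \<Psi> = M ** (S - X) ** transpose N"
      by (simp only: D_def A' BX M_def N_def matrix_diff_ldistrib matrix_diff_rdistrib
          matrix_transpose_mul matrix_mul_assoc)
    with 0 have D0: "\<Phi> *v (D *v (transpose \<Psi> *v x)) = 0" for x
      by (simp only: matrix_vector_mul_assoc matrix_mul_assoc) simp
    have sQ: "subspace SQ" and sP: "subspace SP"
      unfolding SQ_def SP_def by (rule subspace_mat_range)+
    have DQ: "D *v x \<in> SQ" for x
      using 1 B(1) sQ by (auto simp: D_def mat_range_def matrix_vector_mult_diff_rdistrib
          intro!: subspace_diff)
    have DP: "transpose D *v x \<in> SP" for x
    proof -
      have "transpose D = transpose A' - transpose B"
        by (simp add: D_def transpose_def vec_eq_iff)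
      then show ?thesis
        using 2 B(2) sP by (auto simp: mat_range_def matrix_vector_mult_diff_rdistrib
            simp del: transpose_matrix_vector intro!: subspace_diff)
    qed
    have "D *v (transpose \<Psi> *v x) = 0" for x
      using inj_onD[OF inj(1), of "D *v (transpose \<Psi> *v x)" 0] D0 DQ subspace_0[OF sQ] by simp
    then have "D ** transpose \<Psi> = 0"
      by (intro matrix_eqI_vec) (simp only: matrix_vector_mul_assoc[symmetric] matrix_vector_mult_0)
    then have "transpose (D ** transpose \<Psi>) = 0" by (simp add: transpose_def vec_eq_iff)
    then have "\<Psi> ** transpose D = 0" by (simp only: matrix_transpose_mul transpose_transpose)
    then have "\<Psi> *v (transpose D *v x) = 0" for x
      by (simp only: matrix_vector_mul_assoc) simp
    then have "transpose D *v x = 0" for x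
      using inj_onD[OF inj(2), of "transpose D *v x" 0] DP[of x] subspace_0[OF sP]
      by (simp del: transpose_matrix_vector)
    then have "transpose D = 0"
      by (intro matrix_eqI_vec) (simp only: matrix_vector_mult_0)
    then have "D = 0" by (simp add: transpose_def vec_eq_iff)
    then show "B = A'" by (simp add: D_def)
  }
qed

end

(*
  Write E = A - R A T with R, T the orthogonal projectors onto Q and P, U = (Phi R)^+ and
  V = (Psi T)^+. If Phi and Psi are bounded below by sqrt (1 - eps) on Q and P, then U Phi R = R and
  V Psi T = T, so the approximation is R A T + U (Phi E Psi^T) V^T, where U and V have norm at most
  1 / sqrt (1 - eps). If moreover Psi and then Phi stretch the Frobenius norms of E^T and E Psi^T by
  at most sqrt (1 + eps), the error is at most (1 + (1 + eps) / (1 - eps)) |E|, and the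
  factor is 18/7 < 4.2 for eps = 2/9. Each of the four events fails with probability at most delta:
  independence allows all other randomness to be frozen, and the two Frobenius bounds are union
  bounds over at most n vectors.
*)
theory Submission
  imports Defs
begin

section \<open>Borel measurability of the pseudo-inverse, the projectors and the
  approximation\<close>

section \<open>Measurability\<close>

text \<open>Preimages of closed sets are projections of closed sets, hence \<open>F\<^sub>\<sigma>\<close>.\<close>

lemma borel_measurable_closed_graph:
  fixes f :: "'a::euclidean_space \<Rightarrow> 'b::euclidean_space"
  assumes "closed {(x, y). f x = y}"
  shows "f \<in> borel_measurable borel"
  unfolding borel_eq_closed[where 'a = 'b]
proof (rule measurable_measure_of)
  fix C :: "'b set" assume "C \<in> Collect closed"
  \<comment> \<open>Cutting with a ball makes each piece compact, so its projection is compact and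
    hence closed; the projection of a merely closed set need not be closed.\<close>
  define G where "G n = {(x, y). f x = y} \<inter> (UNIV \<times> C) \<inter> cball 0 (real n)" for n
  have "compact (fst ` G n)" for n
    unfolding G_def using assms \<open>C \<in> Collect closed\<close>
    by (intro compact_continuous_image continuous_intros closed_Int_compact closed_Int
        closed_Times compact_cball) auto
  then have "(\<Union>n. fst ` G n) \<in> sets borel"
    by (intro sets.countable_UN) (auto intro: borel_closed compact_imp_closed)
  moreover have "f -` C = (\<Union>n. fst ` G n)"
  proof -
    have "x \<in> (\<Union>n. fst ` G n)" if "f x \<in> C" for x
    proof -
      obtain n :: nat where "norm (x, f x) \<le> real n" using real_arch_simple by blast
      then have "(x, f x) \<in> G n" using that by (simp add: G_def)
      then show ?thesis by force
    qed
    then show ?thesis by (auto simp: G_def)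
  qed
  ultimately show "f -` C \<inter> space borel \<in> sets borel" by simp
qed auto

lemma continuous_on_matrix_mult [continuous_intros]:
  fixes f :: "'a::topological_space \<Rightarrow> real^'n^'m" and g :: "'a \<Rightarrow> real^'k^'n"
  assumes "continuous_on S f" "continuous_on S g"
  shows "continuous_on S (\<lambda>x. f x ** g x)"
  unfolding matrix_matrix_mult_def using assms by (intro continuous_intros)

lemma continuous_on_transpose [continuous_intros]:
  fixes f :: "'a::topological_space \<Rightarrow> real^'n^'m"
  assumes "continuous_on S f"
  shows "continuous_on S (\<lambda>x. transpose (f x))"
  unfolding transpose_def using assms by (intro continuous_intros)

lemma continuous_on_matrix_vector_mult [continuous_intros]:
  fixes f :: "'a::topological_space \<Rightarrow> real^'n^'m"
  assumes "continuous_on S f" "continuous_on S g"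
  shows "continuous_on S (\<lambda>x. f x *v g x)"
  unfolding matrix_vector_mult_def using assms by (intro continuous_intros)

lemma borel_measurable_matrix_mult [measurable (raw)]:
  fixes f :: "'a \<Rightarrow> real^'n^'m" and g :: "'a \<Rightarrow> real^'k^'n"
  assumes "f \<in> borel_measurable M" "g \<in> borel_measurable M"
  shows "(\<lambda>x. f x ** g x) \<in> borel_measurable M"
  using assms by (rule borel_measurable_continuous_Pair) (intro continuous_intros)

lemma borel_measurable_transpose [measurable (raw)]:
  fixes f :: "'a \<Rightarrow> real^'n^'m"
  assumes "f \<in> borel_measurable M"
  shows "(\<lambda>x. transpose (f x)) \<in> borel_measurable M"
  by (rule borel_measurable_continuous_on[OF _ assms]) (intro continuous_intros)

lemma borel_measurable_pinv [measurable]: "(pinv :: real^'n^'m \<Rightarrow> _) \<in> borel_measurable borel"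
proof (rule borel_measurable_closed_graph)
  have "{(A :: real^'n^'m, X). pinv A = X} = {AX. is_pinv (fst AX) (snd AX)}"
    using is_pinv_pinv pinv_eqI by auto
  moreover have "closed {AX :: (real^'n^'m) \<times> (real^'m^'n). is_pinv (fst AX) (snd AX)}"
    unfolding is_pinv_def by (intro closed_Collect_conj closed_Collect_eq continuous_intros)
  ultimately show "closed {(A :: real^'n^'m, X). pinv A = X}" by simp
qed

text \<open>By the normal equations \<open>transpose_pinv_mult\<close> the residual is orthogonal to
  the range. The formula reduces the measurability of random projectors to that of
  \<open>pinv\<close>.\<close>

lemma orth_proj_mat_range: "orth_proj (mat_range X) = X ** pinv X"
proof (rule is_orth_proj_unique[OF subspace_mat_range[of X] orth_proj[OF subspace_mat_range]])
  have "X ** pinv X *v x \<in> mat_range X" for x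
    by (simp add: mat_range_def flip: matrix_vector_mul_assoc)
  moreover have "orthogonal (x - X ** pinv X *v x) (X *v u)" for x u
  proof -
    have "transpose X *v (x - X ** pinv X *v x) = 0"
      by (simp only: matrix_vector_mult_diff_distrib matrix_vector_mul_assoc transpose_pinv_mult) simp
    then show ?thesis
      by (simp add: orthogonal_def inner_commute[of _ "X *v u"] adjoint_transpose)
  qed
  ultimately show "is_orth_proj (X ** pinv X) (mat_range X)"
    by (auto simp: is_orth_proj_def mat_range_def)
qed

lemma borel_measurable_orth_proj_mat_range [measurable]:
  "(\<lambda>X. orth_proj (mat_range X)) \<in> borel_measurable borel"
  unfolding orth_proj_mat_range by measurable

text \<open>Eliminates the bases chosen by \<open>SOME\<close>, whose dependence on the sketches is
  uncontrolled: each basis merges with its pseudo-inverse by \<open>is_onb_matrix_pinv\<close>. What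
  remains is visibly measurable and involves only the projectors.\<close>

lemma single_view_eq_pinv:
  "single_view A \<Omega> \<Gamma> \<Phi> \<Psi> =
    pinv (\<Phi> ** orth_proj (mat_range (A ** transpose \<Omega>))) ** (\<Phi> ** A ** transpose \<Psi>) **
    transpose (pinv (\<Psi> ** orth_proj (mat_range (transpose A ** transpose \<Gamma>))))"
  for \<Omega> :: "real^'n^'l" and \<Gamma> :: "real^'m^'l"
proof -
  obtain Q :: "real^'l^'m" where Q: "is_onb_matrix Q (mat_range (A ** transpose \<Omega>))"
    using is_onb_matrix_exists[OF subspace_mat_range dim_mat_range] by blast
  obtain P :: "real^'l^'n" where P: "is_onb_matrix P (mat_range (transpose A ** transpose \<Gamma>))"
    using is_onb_matrix_exists[OF subspace_mat_range dim_mat_range] by blast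
  show ?thesis
    unfolding single_view_eq[OF Q P]
    by (simp only: is_onb_matrix_pinv[OF Q, symmetric] is_onb_matrix_pinv[OF P, symmetric]
        matrix_transpose_mul matrix_mul_assoc)
qed

section \<open>From mutual independence to probability bounds with frozen variables\<close>

section \<open>Independence\<close>

lemma (in prob_space) indep_vars3_indep_set:
  assumes ind: "indep_vars3 M X Y Z"
  shows "indep_set (generated_events M X) (generated_events M Z)"
proof -
  let ?F = "\<lambda>i::nat. [generated_events M X, generated_events M Y, generated_events M Z] ! i"
  have F: "indep_sets ?F {0, 1, 2}" using ind by (simp add: indep_vars3_def)
  have "prob (a \<inter> b) = prob a * prob b"
    if "a \<in> generated_events M X" "b \<in> generated_events M Z" for a b
    using indep_setsD[OF F, of "{0, 2}" "\<lambda>i. if i = 0 then a else b"] that by (simp add: Int_commute)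
  then show ?thesis
    using F by (auto simp: indep_sets2_eq indep_sets_def)
qed

lemma Int_stable_generated_events: "Int_stable (generated_events M X)"
proof (rule Int_stableI)
  fix a b assume "a \<in> generated_events M X" "b \<in> generated_events M X"
  then obtain A B where "A \<in> sets borel" "B \<in> sets borel"
      "a = X -` A \<inter> space M" "b = X -` B \<inter> space M"
    by (auto simp: generated_events_def)
  then show "a \<inter> b \<in> generated_events M X"
    unfolding generated_events_def by (intro CollectI exI[of _ "A \<inter> B"]) auto
qed

text \<open>The blocks {0, 2} and {1} of an independent family generate independent sigma-algebras,
  and every event of the pair lies in the one generated by the first block.\<close>

lemma (in prob_space) indep_vars3_indep_set_Pair:
  fixes X :: "'a \<Rightarrow> 'b::second_countable_topology" and Z :: "'a \<Rightarrow> 'c::second_countable_topology"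
  assumes ind: "indep_vars3 M X Y Z"
  shows "indep_set (generated_events M (\<lambda>\<omega>. (X \<omega>, Z \<omega>))) (generated_events M Y)"
proof -
  let ?F = "\<lambda>i::nat. [generated_events M X, generated_events M Y, generated_events M Z] ! i"
  let ?I = "case_bool {0, 2} {1 :: nat}"
  have "indep_sets ?F {0, 1, 2}" using ind by (simp add: indep_vars3_def)
  moreover have "(\<Union>j\<in>UNIV. ?I j) = {0, 1, 2}" by (auto simp: UNIV_bool)
  ultimately have "indep_sets (\<lambda>j. sigma_sets (space M) (\<Union>i\<in>?I j. ?F i)) UNIV"
    by (intro indep_sets_collect_sigma)
      (auto simp: Int_stable_generated_events disjoint_family_on_def split: bool.splits)
  moreover have "generated_events M (\<lambda>\<omega>. (X \<omega>, Z \<omega>)) \<subseteq> sigma_sets (space M) (\<Union>i\<in>?I True. ?F i)"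
  proof -
    \<comment> \<open>\<open>N\<close> is \<open>M\<close> coarsened to what \<open>X\<close> and
      \<open>Z\<close> generate. Both are measurable on it, hence so is the pair, because second
      countability makes the Borel sets of the product the product sigma-algebra.\<close>
    define N where "N = sigma (space M) (generated_events M X \<union> generated_events M Z)"
    have N: "space N = space M"
      "sets N = sigma_sets (space M) (generated_events M X \<union> generated_events M Z)"
      by (auto simp: N_def generated_events_def intro!: space_measure_of sets_measure_of)
    have [measurable]: "X \<in> borel_measurable N" "Z \<in> borel_measurable N"
      by (auto simp: measurable_def N generated_events_def)
    have "(\<lambda>\<omega>. (X \<omega>, Z \<omega>)) \<in> borel_measurable N" by measurable
    then have "(\<lambda>\<omega>. (X \<omega>, Z \<omega>)) -` B \<inter> space M \<in> sets N" if "B \<in> sets borel" for B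
      using that measurable_sets[of _ N borel B] by (simp add: N)
    then show ?thesis
      by (auto simp: generated_events_def[of M "\<lambda>\<omega>. (X \<omega>, Z \<omega>)"] N)
  qed
  moreover have "generated_events M Y \<subseteq> sigma_sets (space M) (\<Union>i\<in>?I False. ?F i)" by auto
  ultimately show ?thesis
    unfolding indep_set_def by (elim indep_sets_mono_sets) (auto split: bool.split)
qed

text \<open>Fubini: the law of the pair is a product measure, so the bound may be checked with the
  first variable frozen.\<close>

lemma (in prob_space) prob_indep_ge:
  fixes X :: "'a \<Rightarrow> 'b::second_countable_topology" and Y :: "'a \<Rightarrow> 'c::second_countable_topology"
  assumes [measurable]: "random_variable borel X" "random_variable borel Y"
    and ind: "indep_set (generated_events M X) (generated_events M Y)"
    and S: "Measurable.pred borel (\<lambda>z. S (fst z) (snd z))"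
    and ge: "\<And>x. c \<le> \<P>(\<omega> in M. S x (Y \<omega>))"
  shows "c \<le> \<P>(\<omega> in M. S (X \<omega>) (Y \<omega>))"
proof -
  interpret X: prob_space "distr M borel X" by (rule prob_space_distr) measurable
  interpret Y: prob_space "distr M borel Y" by (rule prob_space_distr) measurable
  \<comment> \<open>Independence is the product formula on rectangles, and these determine the
    product measure.\<close>
  have eq: "distr M borel X \<Otimes>\<^sub>M distr M borel Y = distr M (borel \<Otimes>\<^sub>M borel) (\<lambda>\<omega>. (X \<omega>, Y \<omega>))"
  proof (rule pair_measure_eqI)
    fix A B assume "A \<in> sets (distr M borel X)" "B \<in> sets (distr M borel Y)"
    then have [measurable]: "A \<in> sets borel" "B \<in> sets borel" by auto
    have "prob ((X -` A \<inter> space M) \<inter> (Y -` B \<inter> space M)) =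
        prob (X -` A \<inter> space M) * prob (Y -` B \<inter> space M)"
      by (rule indep_setD[OF ind]) (auto simp: generated_events_def)
    moreover have "(\<lambda>\<omega>. (X \<omega>, Y \<omega>)) -` (A \<times> B) \<inter> space M =
        (X -` A \<inter> space M) \<inter> (Y -` B \<inter> space M)" by auto
    ultimately show "emeasure (distr M borel X) A * emeasure (distr M borel Y) B =
        emeasure (distr M (borel \<Otimes>\<^sub>M borel) (\<lambda>\<omega>. (X \<omega>, Y \<omega>))) (A \<times> B)"
      by (simp add: emeasure_distr emeasure_eq_measure ennreal_mult'')
  qed (auto simp: X.sigma_finite_measure_axioms Y.sigma_finite_measure_axioms)
  let ?S = "{z. S (fst z) (snd z)}"
  have S': "?S \<in> sets (borel \<Otimes>\<^sub>M borel)" using S unfolding borel_prod pred_def by simp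
  have "emeasure M {\<omega> \<in> space M. S (X \<omega>) (Y \<omega>)} =
      emeasure (distr M (borel \<Otimes>\<^sub>M borel) (\<lambda>\<omega>. (X \<omega>, Y \<omega>))) ?S"
    using S' by (subst emeasure_distr) (auto intro!: arg_cong[where f = "emeasure M"])
  \<comment> \<open>The slice at \<open>x\<close> is the event with the first variable frozen at
    \<open>x\<close>; it has probability at least \<open>c\<close> for every \<open>x\<close>, and
    integration preserves the bound.\<close>
  also have "\<dots> = (\<integral>\<^sup>+x. emeasure (distr M borel Y) (Pair x -` ?S) \<partial>distr M borel X)"
    unfolding eq[symmetric] using S' by (intro Y.emeasure_pair_measure_alt) simp
  also have "\<dots> \<ge> (\<integral>\<^sup>+x. ennreal c \<partial>distr M borel X)"
  proof (rule nn_integral_mono)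
    fix x
    have "Pair x -` ?S \<in> sets borel" using S' by (rule sets_Pair1)
    then have "emeasure (distr M borel Y) (Pair x -` ?S) = emeasure M {\<omega> \<in> space M. S x (Y \<omega>)}"
      by (subst emeasure_distr) (auto intro!: arg_cong[where f = "emeasure M"])
    then show "ennreal c \<le> emeasure (distr M borel Y) (Pair x -` ?S)"
      using ge[of x] by (simp add: emeasure_eq_measure ennreal_leI)
  qed
  also have "(\<integral>\<^sup>+x. ennreal c \<partial>distr M borel X) = ennreal c"
    by (simp add: X.emeasure_space_1[simplified])
  finally show ?thesis by (simp add: emeasure_eq_measure)
qed


section \<open>Deterministic error bound in the Frobenius norm\<close>

section \<open>Sketched least squares\<close>

text \<open>The nested vector norm sums over rows. Summing over columns instead lets bounds on
  \<open>F *v x\<close> carry over to products with \<open>F\<close> on the left.\<close>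

lemma norm_matrix_sq: "(norm X)\<^sup>2 = (\<Sum>j\<in>UNIV. (norm (column j X))\<^sup>2)"
  for X :: "real^'n^'m"
proof -
  have "(norm (transpose X))\<^sup>2 = (\<Sum>j\<in>UNIV. (norm (column j X))\<^sup>2)"
    by (simp add: power2_norm_eq_inner inner_vec_def transpose_def column_def)
  then show ?thesis by (simp add: power2_norm_eq_inner inner_transpose)
qed

lemma norm_transpose: "norm (transpose X) = norm X" for X :: "real^'n^'m"
  by (simp add: norm_eq_sqrt_inner inner_transpose)

lemma column_matrix_mult: "column j (X ** Y) = X *v column j Y"
  for X :: "real^'n^'m" and Y :: "real^'k^'n"
  by (simp add: column_def matrix_matrix_mult_def matrix_vector_mult_def vec_eq_iff)

text \<open>The squared norm of \<open>R ** X\<close> is the inner product of \<open>X\<close> with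
  \<open>R ** X\<close>, so Cauchy-Schwarz applies.\<close>

lemma norm_proj_mult_le:
  fixes R :: "real^'m^'m" and X :: "real^'n^'m"
  assumes "transpose R = R" "R ** R = R"
  shows "norm (R ** X) \<le> norm X"
proof -
  have "(norm (R ** X))\<^sup>2 = X \<bullet> (R ** X)"
    using inner_matrix_mult_left[of "R ** X" R X] assms
    by (simp add: power2_norm_eq_inner matrix_mul_assoc inner_commute)
  also have "\<dots> \<le> norm X * norm (R ** X)" by (rule norm_cauchy_schwarz)
  finally have "norm (R ** X) * norm (R ** X) \<le> norm X * norm (R ** X)"
    by (simp add: power2_eq_square)
  then show ?thesis by (cases "norm (R ** X) = 0") auto
qed

lemma norm_mult_coisometry:
  fixes X :: "real^'s^'m" and W :: "real^'k^'s"
  assumes "X ** (W ** transpose W) = X"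
  shows "norm (X ** W) = norm X"
  using inner_matrix_mult_right[of X "X ** W" W] assms
  by (simp add: norm_eq_sqrt_inner matrix_mul_assoc)

lemma is_orth_proj_idem:
  assumes "is_orth_proj R S" shows "R ** R = R"
proof (rule matrix_eqI_vec)
  fix x
  have "(R *v x - R *v (R *v x)) \<bullet> (R *v u) = 0" for u
    using assms by (auto simp: is_orth_proj_def orthogonal_def)
  from this[of x] this[of "R *v x"]
  have "(R *v x - R *v (R *v x)) \<bullet> (R *v x - R *v (R *v x)) = 0"
    by (simp add: inner_diff_right)
  then show "R ** R *v x = R *v x" by (simp add: matrix_vector_mul_assoc[symmetric])
qed

text \<open>\<open>F\<close> is bounded below by the square root of \<open>c\<close> on the range of
  the orthogonal projector \<open>R\<close>. The instances are \<Phi> on Q and \<Psi> on P, with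
  \<open>c\<close> equal to 1 - \<epsilon>.\<close>

locale sketched_projection =
  fixes F :: "real^'n^'s" and R :: "real^'n^'n" and c :: real
  assumes R_sym: "transpose R = R" and R_idem: "R ** R = R"
    and c_pos: "0 < c" and lower: "\<And>v. c * (norm (R *v v))\<^sup>2 \<le> (norm (F *v (R *v v)))\<^sup>2"
begin

definition "U = pinv (F ** R)"

lemma lower_matrix: "c * (norm (R ** X))\<^sup>2 \<le> (norm (F ** R ** X))\<^sup>2"
  unfolding norm_matrix_sq sum_distrib_left
  by (rule sum_mono) (use lower in \<open>simp add: column_matrix_mult matrix_vector_mul_assoc[symmetric]\<close>)

lemma U_pinv: "is_pinv (F ** R) U"
  unfolding U_def by (rule is_pinv_pinv)

text \<open>The range of a pseudo-inverse lies in the row space of the original matrix, and the row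
  space of \<open>F ** R\<close> lies in the range of \<open>R\<close>.\<close>

lemma R_U: "R ** U = U"
proof -
  have "U = transpose (U ** (F ** R)) ** U"
    using U_pinv by (simp add: is_pinv_def)
  also have "\<dots> = R ** transpose F ** transpose U ** U"
    by (simp add: matrix_transpose_mul R_sym)
  finally have U: "U = R ** (transpose F ** transpose U ** U)" by (simp add: matrix_mul_assoc)
  then have "R ** U = R ** R ** (transpose F ** transpose U ** U)" by (metis matrix_mul_assoc)
  then show ?thesis using U R_idem by simp
qed

text \<open>The difference \<open>?D\<close> has its columns in the range of \<open>R\<close> and is
  annihilated by \<open>F ** R\<close>, so the lower bound forces it to vanish.\<close>

lemma U_F_R: "U ** (F ** R) = R"
proof -
  let ?D = "U ** (F ** R) - R"
  have RD: "R ** ?D = ?D"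
    by (simp add: matrix_diff_ldistrib matrix_mul_assoc R_U R_idem)
  have "F ** R ** ?D = F ** R ** U ** (F ** R) - F ** (R ** R)"
    by (simp only: matrix_diff_ldistrib matrix_mul_assoc)
  also have "\<dots> = 0" using U_pinv by (simp add: is_pinv_def R_idem)
  finally have "F ** R ** ?D = 0" .
  then have "c * (norm ?D)\<^sup>2 \<le> 0" using lower_matrix[of ?D] RD by simp
  then show ?thesis using c_pos by (simp add: mult_le_0_iff)
qed

text \<open>The columns of \<open>U ** C\<close> lie in the range of \<open>R\<close>, where
  \<open>F\<close> is bounded below, and \<open>F ** R ** U\<close> is an orthogonal projector and
  therefore a contraction.\<close>

lemma norm_U_mult: "c * (norm (U ** C))\<^sup>2 \<le> (norm C)\<^sup>2"
proof -
  have "c * (norm (U ** C))\<^sup>2 \<le> (norm (F ** R ** U ** C))\<^sup>2"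
    using lower_matrix[of "U ** C"] by (simp add: matrix_mul_assoc R_U)
  also have "\<dots> \<le> (norm C)\<^sup>2"
  proof (intro power_mono norm_proj_mult_le)
    show "F ** R ** U ** (F ** R ** U) = F ** R ** U"
      using U_pinv by (simp add: is_pinv_def matrix_mul_assoc)
  qed (use U_pinv in \<open>auto simp: is_pinv_def\<close>)
  finally show ?thesis .
qed

end

text \<open>The sandwich reproduces the compression \<open>R ** A ** T\<close>, so only the residual \<open>E\<close> is distorted.\<close>

lemma norm_pinv_sandwich_le:
  fixes A :: "real^'n^'m" and F :: "real^'m^'s" and G :: "real^'n^'t" and c d :: real
  assumes FR: "sketched_projection F R c" and GT: "sketched_projection G T c"
    and d: "0 \<le> d"
  defines "E \<equiv> A - R ** A ** T"
  assumes G: "(norm (G ** transpose E))\<^sup>2 \<le> d * (norm E)\<^sup>2"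
    and F: "(norm (F ** (E ** transpose G)))\<^sup>2 \<le> d * (norm (E ** transpose G))\<^sup>2"
  shows "norm (A - pinv (F ** R) ** (F ** A ** transpose G) ** transpose (pinv (G ** T)))
    \<le> (1 + d / c) * norm E"
proof -
  interpret F: sketched_projection F R c by fact
  interpret G: sketched_projection G T c by fact
  let ?C = "F ** E ** transpose G"
  let ?Z = "F.U ** ?C ** transpose G.U"
  \<comment> \<open>Each pseudo-inverse undoes its sketch on the compressed matrix:
    \<open>U_F_R\<close> applies on the left, and its transpose on the right.\<close>
  have "F.U ** (F ** (R ** A ** T) ** transpose G) ** transpose G.U =
      (F.U ** (F ** R)) ** A ** transpose (G.U ** (G ** T))"
    by (simp add: matrix_transpose_mul matrix_mul_assoc G.R_sym)
  then have "F.U ** (F ** (R ** A ** T) ** transpose G) ** transpose G.U = R ** A ** T"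
    by (simp only: F.U_F_R G.U_F_R G.R_sym)
  then have "F.U ** (F ** A ** transpose G) ** transpose G.U - R ** A ** T = ?Z"
    by (simp add: E_def matrix_diff_ldistrib matrix_diff_rdistrib)
  then have eq: "A - F.U ** (F ** A ** transpose G) ** transpose G.U = E - ?Z"
    by (simp add: E_def algebra_simps)
  have "norm (?C ** transpose G.U) = norm (G.U ** transpose ?C)"
    by (metis norm_transpose matrix_transpose_mul transpose_transpose)
  then have 1: "c * (norm (?C ** transpose G.U))\<^sup>2 \<le> (norm ?C)\<^sup>2"
    using G.norm_U_mult[of "transpose ?C"] by (simp add: norm_transpose)
  \<comment> \<open>Each pseudo-inverse costs a factor 1 / sqrt \<open>c\<close> and each sketch a
    factor sqrt \<open>d\<close>; two of each give \<open>d / c\<close>.\<close>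
  have "(c * norm ?Z)\<^sup>2 = c * (c * (norm (F.U ** (?C ** transpose G.U)))\<^sup>2)"
    by (simp add: power_mult_distrib power2_eq_square matrix_mul_assoc)
  also have "\<dots> \<le> c * (norm (?C ** transpose G.U))\<^sup>2"
    using F.norm_U_mult F.c_pos by (intro mult_left_mono) auto
  also note 1
  also have "(norm ?C)\<^sup>2 \<le> d * (norm (E ** transpose G))\<^sup>2"
    using F by (simp add: matrix_mul_assoc)
  also have "norm (E ** transpose G) = norm (G ** transpose E)"
    by (metis norm_transpose matrix_transpose_mul transpose_transpose)
  also have "d * (norm (G ** transpose E))\<^sup>2 \<le> d * (d * (norm E)\<^sup>2)"
    using G d by (intro mult_left_mono)
  also have "\<dots> = (d * norm E)\<^sup>2" by (simp add: power_mult_distrib power2_eq_square)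
  finally have "c * norm ?Z \<le> d * norm E"
    using d by (intro power2_le_imp_le[of "c * norm ?Z"]) auto
  then have "norm ?Z \<le> d / c * norm E" using F.c_pos by (simp add: field_simps)
  then have "norm (E - ?Z) \<le> (1 + d / c) * norm E"
    using norm_triangle_ineq4[of E ?Z] by (simp add: algebra_simps)
  then show ?thesis unfolding F.U_def[symmetric] G.U_def[symmetric] eq .
qed

text \<open>Insert \<open>R ** A\<close> between the two terms; the projector \<open>R\<close>
  contracts what is left of the column-side residual.\<close>

lemma norm_residual_le:
  fixes A :: "real^'n^'m"
  assumes "transpose R = R" "R ** R = R"
  shows "norm (A - R ** A ** T) \<le> norm (A - R ** A) + norm (A - A ** T)"
proof -
  have "A - R ** A ** T = (A - R ** A) + R ** (A - A ** T)"
    by (simp add: matrix_diff_ldistrib matrix_mul_assoc)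
  then have "norm (A - R ** A ** T) \<le> norm (A - R ** A) + norm (R ** (A - A ** T))"
    by (simp only: norm_triangle_ineq)
  then show ?thesis using norm_proj_mult_le[OF assms, of "A - A ** T"] by simp
qed

section \<open>From the OSE property to lower bounds on subspaces and Frobenius bounds on
  matrices\<close>

section \<open>Embeddings of arbitrary subspaces, vectors and matrices\<close>

text \<open>\<open>OSE\<close> speaks of one exact dimension, while the sketched ranges may have a
  smaller one. A basis of \<open>V\<close> is extended to one of the whole space, and an
  intermediate set of \<open>k\<close> vectors is picked.\<close>

lemma subspace_superset_of_dim:
  fixes V :: "(real^'n) set"
  assumes "subspace V" "dim V \<le> k" "k \<le> CARD('n)"
  obtains W where "subspace W" "V \<subseteq> W" "dim W = k"
proof -
  obtain B where B: "B \<subseteq> V" "independent B" "V \<subseteq> span B" "card B = dim V"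
    using basis_exists by blast
  obtain C where C: "B \<subseteq> C" "independent C" "UNIV \<subseteq> span C"
    by (rule maximal_independent_subset_extend[OF subset_UNIV B(2)])
  have "card C = CARD('n)"
    using C(2) dim_eq_card[of C UNIV] top.extremum_uniqueI[OF C(3)] by simp
  moreover have "finite C" using C(2) by (rule independent_imp_finite)
  ultimately obtain D where D: "B \<subseteq> D" "D \<subseteq> C" "card D = k"
    using exists_subset_between[of B k C] B(4) C(1) assms by auto
  have "independent D" using C(2) D(2) by (rule independent_mono)
  then have "dim (span D) = k" using D(3) by (simp add: dim_eq_card_independent)
  moreover have "V \<subseteq> span D" using B(3) span_mono[OF D(1)] by blast
  ultimately show ?thesis using that subspace_span by blast
qed

lemma (in prob_space) OSE_subspace:
  fixes \<Theta> :: "'a \<Rightarrow> real^'n^'s"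
  assumes ose: "OSE M \<Theta> \<epsilon> \<delta> d" and V: "subspace V" "dim V \<le> d"
  shows "1 - \<delta> \<le> \<P>(\<omega> in M. \<forall>x\<in>V. \<bar>(norm x)\<^sup>2 - (norm (\<Theta> \<omega> *v x))\<^sup>2\<bar> \<le> \<epsilon> * (norm x)\<^sup>2)"
proof -
  have "dim V \<le> min d CARD('n)" using V dim_subset_UNIV[of V] by simp
  then obtain W where W: "subspace W" "V \<subseteq> W" "dim W = min d CARD('n)"
    using subspace_superset_of_dim[OF V(1)] by (metis min.cobounded2)
  have [measurable]: "\<Theta> \<in> borel_measurable M" using ose by (simp add: OSE_def)
  let ?P = "\<lambda>H v. \<bar>(norm v)\<^sup>2 - (norm (H *v v))\<^sup>2\<bar> \<le> \<epsilon> * (norm v)\<^sup>2"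
  \<comment> \<open>The quantifier over \<open>V\<close> is uncountable, but an intersection of
    closed conditions on \<open>H\<close> is closed, hence measurable.\<close>
  have "closed {H :: real^'n^'s. \<forall>v\<in>V. ?P H v}"
    unfolding Ball_def by (intro closed_Collect_all closed_Collect_imp closed_Collect_le
        continuous_intros) simp
  then have [measurable]: "Measurable.pred borel (\<lambda>H :: real^'n^'s. \<forall>v\<in>V. ?P H v)"
    by (simp add: pred_def borel_closed)
  have "1 - \<delta> \<le> \<P>(\<omega> in M. \<forall>x\<in>W. ?P (\<Theta> \<omega>) x)"
    using ose W by (simp add: OSE_def)
  also have "\<dots> \<le> \<P>(\<omega> in M. \<forall>x\<in>V. ?P (\<Theta> \<omega>) x)"
    using W(2) by (intro finite_measure_mono) auto
  finally show ?thesis .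
qed

lemma (in prob_space) OSE_vector:
  fixes \<Theta> :: "'a \<Rightarrow> real^'n^'s"
  assumes "OSE M \<Theta> \<epsilon> \<delta> 1"
  shows "1 - \<delta> \<le> \<P>(\<omega> in M. (norm (\<Theta> \<omega> *v x))\<^sup>2 \<le> (1 + \<epsilon>) * (norm x)\<^sup>2)"
proof -
  have [measurable]: "\<Theta> \<in> borel_measurable M" using assms by (simp add: OSE_def)
  have "closed {H :: real^'n^'s. (norm (H *v x))\<^sup>2 \<le> (1 + \<epsilon>) * (norm x)\<^sup>2}"
    by (intro closed_Collect_le continuous_intros)
  then have [measurable]: "Measurable.pred borel
      (\<lambda>H :: real^'n^'s. (norm (H *v x))\<^sup>2 \<le> (1 + \<epsilon>) * (norm x)\<^sup>2)"
    by (simp add: pred_def borel_closed)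
  \<comment> \<open>The dimension is 0 when \<open>x\<close> is zero, which
    \<open>OSE_subspace\<close> allows.\<close>
  have "dim (span {x}) \<le> 1" using dim_le_card'[of "{x}"] by simp
  then have "1 - \<delta> \<le> \<P>(\<omega> in M. \<forall>y\<in>span {x}.
      \<bar>(norm y)\<^sup>2 - (norm (\<Theta> \<omega> *v y))\<^sup>2\<bar> \<le> \<epsilon> * (norm y)\<^sup>2)"
    by (intro OSE_subspace[OF assms] subspace_span)
  also have "\<dots> \<le> \<P>(\<omega> in M. (norm (\<Theta> \<omega> *v x))\<^sup>2 \<le> (1 + \<epsilon>) * (norm x)\<^sup>2)"
  proof (intro finite_measure_mono subsetI CollectI conjI; clarify?)
    fix \<omega> assume "\<forall>y\<in>span {x}. \<bar>(norm y)\<^sup>2 - (norm (\<Theta> \<omega> *v y))\<^sup>2\<bar> \<le> \<epsilon> * (norm y)\<^sup>2"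
    then have "\<bar>(norm x)\<^sup>2 - (norm (\<Theta> \<omega> *v x))\<^sup>2\<bar> \<le> \<epsilon> * (norm x)\<^sup>2"
      by (simp add: span_base)
    then show "(norm (\<Theta> \<omega> *v x))\<^sup>2 \<le> (1 + \<epsilon>) * (norm x)\<^sup>2" by (simp add: algebra_simps)
  qed measurable
  finally show ?thesis .
qed

text \<open>The matrix \<open>B\<close> may have more columns than the union bound can afford. Rotating its row space
  onto coordinates (the factor \<open>W\<close>) preserves both norms and leaves \<open>CARD('n)\<close> columns.\<close>

lemma (in prob_space) OSE_matrix:
  fixes \<Theta> :: "'a \<Rightarrow> real^'n^'s" and B :: "real^'k^'n"
  assumes ose: "OSE M \<Theta> \<epsilon> (\<delta> / N) 1" and N: "real CARD('n) \<le> N"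
  shows "1 - \<delta> \<le> \<P>(\<omega> in M. (norm (\<Theta> \<omega> ** B))\<^sup>2 \<le> (1 + \<epsilon>) * (norm B)\<^sup>2)"
proof -
  have N_pos: "0 < N" using N by (rule less_le_trans[rotated]) simp
  have \<delta>: "0 < \<delta> / N" and [measurable]: "\<Theta> \<in> borel_measurable M"
    using ose by (auto simp: OSE_def)
  \<comment> \<open>The row space of \<open>B\<close> is the range of a matrix with
    \<open>CARD('n)\<close> columns, so \<open>CARD('n)\<close> columns can hold its orthonormal
    basis, however large \<open>'k\<close> is.\<close>
  obtain W :: "real^'n^'k" where W: "is_onb_matrix W (mat_range (transpose B))"
    using is_onb_matrix_exists[OF subspace_mat_range dim_mat_range] by blast
  have "W ** transpose W ** transpose B = transpose B"
    using mat_range_subset_iff[OF W] by blast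
  from arg_cong[OF this, of transpose] have BW: "B ** (W ** transpose W) = B"
    by (simp add: matrix_transpose_mul)
  then have TBW: "H ** B ** (W ** transpose W) = H ** B" for H :: "real^'n^'s"
    by (metis matrix_mul_assoc)
  let ?b = "\<lambda>j. column j (B ** W)"
  define G where "G j = {\<omega> \<in> space M. (norm (\<Theta> \<omega> *v ?b j))\<^sup>2 \<le> (1 + \<epsilon>) * (norm (?b j))\<^sup>2}" for j
  have G [measurable]: "G j \<in> events" for j
  proof -
    have "closed {H :: real^'n^'s. (norm (H *v ?b j))\<^sup>2 \<le> (1 + \<epsilon>) * (norm (?b j))\<^sup>2}"
      by (intro closed_Collect_le continuous_intros)
    then have [measurable]: "Measurable.pred borel
        (\<lambda>H :: real^'n^'s. (norm (H *v ?b j))\<^sup>2 \<le> (1 + \<epsilon>) * (norm (?b j))\<^sup>2)"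
      by (simp add: pred_def borel_closed)
    show ?thesis unfolding G_def by measurable
  qed
  have "prob (space M - G j) \<le> \<delta> / N" for j
    using OSE_vector[OF ose, of "?b j"] prob_compl[OF G, of j] by (simp add: G_def)
  then have "(\<Sum>j\<in>(UNIV :: 'n set). prob (space M - G j)) \<le> (\<Sum>j\<in>(UNIV :: 'n set). \<delta> / N)"
    by (intro sum_mono)
  moreover have "prob (\<Union>j. space M - G j) \<le> (\<Sum>j\<in>(UNIV :: 'n set). prob (space M - G j))"
    using G by (intro finite_measure_subadditive_finite) auto
  moreover have "(\<Sum>j\<in>(UNIV :: 'n set). \<delta> / N) = CARD('n) * (\<delta> / N)" by simp
  \<comment> \<open>The union bound has \<open>CARD('n)\<close> terms of size at most \<delta> /
    \<open>N\<close>. The slack in \<open>N\<close> serves \<Phi>, which acts on the smaller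
    dimension m but has its failure probability divided by n.\<close>
  moreover have "CARD('n) * (\<delta> / N) \<le> N * (\<delta> / N)" using N \<delta> by (intro mult_right_mono) auto
  moreover have "N * (\<delta> / N) = \<delta>" using N_pos by simp
  ultimately have "1 - \<delta> \<le> 1 - prob (\<Union>j. space M - G j)" by linarith
  also have "\<dots> = prob (space M - (\<Union>j. space M - G j))"
    using G by (intro prob_compl[symmetric]) auto
  also have "\<dots> \<le> \<P>(\<omega> in M. (norm (\<Theta> \<omega> ** B))\<^sup>2 \<le> (1 + \<epsilon>) * (norm B)\<^sup>2)"
  proof (intro finite_measure_mono subsetI)
    fix \<omega> assume \<omega>: "\<omega> \<in> space M - (\<Union>j. space M - G j)"
    have "(norm (\<Theta> \<omega> ** B))\<^sup>2 = (norm (\<Theta> \<omega> ** (B ** W)))\<^sup>2"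
      using norm_mult_coisometry[OF TBW] by (simp add: matrix_mul_assoc)
    also have "\<dots> = (\<Sum>j\<in>UNIV. (norm (\<Theta> \<omega> *v ?b j))\<^sup>2)"
      by (simp only: norm_matrix_sq column_matrix_mult)
    also have "\<dots> \<le> (\<Sum>j\<in>UNIV. (1 + \<epsilon>) * (norm (?b j))\<^sup>2)"
      using \<omega> by (intro sum_mono) (auto simp: G_def)
    also have "\<dots> = (1 + \<epsilon>) * (norm (B ** W))\<^sup>2"
      by (simp add: norm_matrix_sq[of "B ** W"] sum_distrib_left)
    finally show "\<omega> \<in> {\<omega> \<in> space M. (norm (\<Theta> \<omega> ** B))\<^sup>2 \<le> (1 + \<epsilon>) * (norm B)\<^sup>2}"
      using \<omega> norm_mult_coisometry[OF BW] by simp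
  qed measurable
  finally show ?thesis .
qed

lemma pred_lower_bound [measurable (raw)]:
  fixes R :: "'a \<Rightarrow> real^'n^'n" and F :: "'a \<Rightarrow> real^'n^'s"
  assumes [measurable]: "R \<in> borel_measurable M" "F \<in> borel_measurable M"
  shows "Measurable.pred M (\<lambda>x. \<forall>v. c * (norm (R x *v v))\<^sup>2 \<le> (norm (F x *v (R x *v v)))\<^sup>2)"
proof -
  let ?P = "\<lambda>z. \<forall>v. c * (norm (fst z *v v))\<^sup>2 \<le> (norm (snd z *v (fst z *v v)))\<^sup>2"
  have "closed {z :: (real^'n^'n) \<times> (real^'n^'s). ?P z}"
    by (intro closed_Collect_all closed_Collect_le continuous_intros)
  then have "Measurable.pred borel (\<lambda>z :: (real^'n^'n) \<times> (real^'n^'s). ?P z)"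
    by (simp add: pred_def borel_closed)
  moreover have "(\<lambda>x. (R x, F x)) \<in> borel_measurable M" by measurable
  ultimately have "Measurable.pred M (\<lambda>x. ?P (R x, F x))" by (rule measurable_compose[rotated])
  then show ?thesis by simp
qed

text \<open>Ranging over all \<open>v\<close> through \<open>R\<close> instead of over
  \<open>V\<close> makes the event a closed condition on \<open>R\<close> and the sketch together,
  so it stays measurable when the subspace is random (\<open>pred_lower_bound\<close>).\<close>

lemma (in prob_space) OSE_lower_bound:
  fixes \<Theta> :: "'a \<Rightarrow> real^'n^'s"
  assumes ose: "OSE M \<Theta> \<epsilon> \<delta> d" and R: "is_orth_proj R V" and V: "subspace V" "dim V \<le> d"
  shows "1 - \<delta> \<le> \<P>(\<omega> in M. \<forall>v. (1 - \<epsilon>) * (norm (R *v v))\<^sup>2 \<le> (norm (\<Theta> \<omega> *v (R *v v)))\<^sup>2)"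
proof -
  have [measurable]: "\<Theta> \<in> borel_measurable M" using ose by (simp add: OSE_def)
  have "1 - \<delta> \<le> \<P>(\<omega> in M. \<forall>x\<in>V. \<bar>(norm x)\<^sup>2 - (norm (\<Theta> \<omega> *v x))\<^sup>2\<bar> \<le> \<epsilon> * (norm x)\<^sup>2)"
    using OSE_subspace[OF ose V] .
  also have "\<dots> \<le> \<P>(\<omega> in M. \<forall>v. (1 - \<epsilon>) * (norm (R *v v))\<^sup>2 \<le> (norm (\<Theta> \<omega> *v (R *v v)))\<^sup>2)"
  proof (intro finite_measure_mono subsetI CollectI conjI allI; clarify?)
    fix \<omega> v assume "\<forall>x\<in>V. \<bar>(norm x)\<^sup>2 - (norm (\<Theta> \<omega> *v x))\<^sup>2\<bar> \<le> \<epsilon> * (norm x)\<^sup>2"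
    moreover have "R *v v \<in> V" using R by (simp add: is_orth_proj_def)
    ultimately have "\<bar>(norm (R *v v))\<^sup>2 - (norm (\<Theta> \<omega> *v (R *v v)))\<^sup>2\<bar> \<le> \<epsilon> * (norm (R *v v))\<^sup>2"
      by blast
    then show "(1 - \<epsilon>) * (norm (R *v v))\<^sup>2 \<le> (norm (\<Theta> \<omega> *v (R *v v)))\<^sup>2"
      by (simp add: algebra_simps)
  qed measurable
  finally show ?thesis .
qed

lemma sketched_projection_orth_proj:
  assumes "subspace V" "0 < c"
    and "\<forall>v. c * (norm (orth_proj V *v v))\<^sup>2 \<le> (norm (F *v (orth_proj V *v v)))\<^sup>2"
  shows "sketched_projection F (orth_proj V) c"
  using assms is_orth_proj_sym[OF orth_proj[OF assms(1)]] is_orth_proj_idem[OF orth_proj[OF assms(1)]]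
  by (simp add: sketched_projection_def)

lemma (in prob_space) prob_conj_ge:
  assumes [measurable]: "Measurable.pred M P" "Measurable.pred M Q"
    and "1 - a \<le> \<P>(\<omega> in M. P \<omega>)" "1 - b \<le> \<P>(\<omega> in M. Q \<omega>)"
  shows "1 - (a + b) \<le> \<P>(\<omega> in M. P \<omega> \<and> Q \<omega>)"
proof -
  have "\<P>(\<omega> in M. P \<omega>) \<le> prob ({\<omega> \<in> space M. P \<omega> \<and> Q \<omega>} \<union> (space M - {\<omega> \<in> space M. Q \<omega>}))"
    by (intro finite_measure_mono) auto
  also have "\<dots> \<le> \<P>(\<omega> in M. P \<omega> \<and> Q \<omega>) + prob (space M - {\<omega> \<in> space M. Q \<omega>})"
    by (intro measure_Un_le) auto
  also have "prob (space M - {\<omega> \<in> space M. Q \<omega>}) = 1 - \<P>(\<omega> in M. Q \<omega>)"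
    by (intro prob_compl) measurable
  finally show ?thesis using assms(3,4) by simp
qed

theorem mainTheorem2:
  fixes M :: "'w measure"
    and A :: "real^'n^'m"
    and \<Omega> :: "'w \<Rightarrow> real^'n^'l" and \<Gamma> :: "'w \<Rightarrow> real^'m^'l"
    and \<Phi> :: "'w \<Rightarrow> real^'m^'s" and \<Psi> :: "'w \<Rightarrow> real^'n^'s"
    and \<delta> \<epsilon> :: real
  assumes "prob_space M"
    and "CARD('m) \<le> CARD('n)" and "CARD('l) \<le> CARD('s)"
    and "\<Omega> \<in> borel_measurable M" and "\<Gamma> \<in> borel_measurable M"
    and "\<Phi> \<in> borel_measurable M" and "\<Psi> \<in> borel_measurable M"
    and "indep_vars3 M (\<lambda>\<omega>. (\<Omega> \<omega>, \<Gamma> \<omega>)) \<Phi> \<Psi>"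
    and "0 < \<delta>" and "\<delta> < 1" and "0 \<le> \<epsilon>" and "\<epsilon> \<le> 2 / 9"
    and "OSE M \<Phi> \<epsilon> \<delta> CARD('l)" and "OSE M \<Phi> \<epsilon> (\<delta> / CARD('n)) 1"
    and "OSE M \<Psi> \<epsilon> \<delta> CARD('l)" and "OSE M \<Psi> \<epsilon> (\<delta> / CARD('n)) 1"
  shows "\<P>(\<omega> in M.
           let proj_Q = orth_proj (mat_range (A ** transpose (\<Omega> \<omega>)));
               proj_P = orth_proj (mat_range (transpose A ** transpose (\<Gamma> \<omega>)))
           in frobenius_norm (A - single_view A (\<Omega> \<omega>) (\<Gamma> \<omega>) (\<Phi> \<omega>) (\<Psi> \<omega>))
                \<le> 4.2 * frobenius_norm (A - proj_Q ** A ** proj_P) \<and>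
              4.2 * frobenius_norm (A - proj_Q ** A ** proj_P)
                \<le> 4.2 * (frobenius_norm (A - proj_Q ** A) + frobenius_norm (A - A ** proj_P)))
         \<ge> 1 - 4 * \<delta>"
proof -
  interpret prob_space M by fact
  note [measurable] = assms(4-7)
  \<comment> \<open>The subspaces and the residual are functions of sketch values rather than of
    \<omega>, so that they can be held fixed in \<open>prob_indep_ge\<close>.\<close>
  define VQ where "VQ w = mat_range (A ** transpose w)" for w :: "real^'n^'l"
  define VP where "VP g = mat_range (transpose A ** transpose g)" for g :: "real^'m^'l"
  define E where "E z = A - orth_proj (VQ (fst z)) ** A ** orth_proj (VP (snd z))" for z
  have V: "subspace (VQ w)" "dim (VQ w) \<le> CARD('l)" "subspace (VP g)" "dim (VP g) \<le> CARD('l)" for w g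
    unfolding VQ_def VP_def by (simp_all add: subspace_mat_range dim_mat_range)
  have [measurable]: "(\<lambda>w. orth_proj (VQ w)) \<in> borel_measurable borel"
      "(\<lambda>g. orth_proj (VP g)) \<in> borel_measurable borel"
    unfolding VQ_def VP_def by measurable
  have [measurable]: "E \<in> borel_measurable (borel \<Otimes>\<^sub>M borel)"
    unfolding E_def by measurable
  let ?X = "\<lambda>\<omega>. (\<Omega> \<omega>, \<Gamma> \<omega>)"
  let ?XY = "\<lambda>\<omega>. (?X \<omega>, \<Psi> \<omega>)"
  have X [measurable]: "?X \<in> borel_measurable M" and XY: "?XY \<in> borel_measurable M" by measurable
  have ind3: "indep_vars3 M ?X \<Phi> \<Psi>" by fact
  note ind\<Psi> = indep_vars3_indep_set[OF ind3] and ind\<Phi> = indep_vars3_indep_set_Pair[OF ind3]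

  \<comment> \<open>\<open>?P1\<close> and \<open>?P2\<close> are the lower bounds on Q and P;
    \<open>?P3\<close> and \<open>?P4\<close> bound the stretching of the residual, first by \<Psi>
    and then by \<Phi>. In \<open>?P4\<close> the matrix embedded by \<Phi> contains \<Psi>, so
    \<Psi> has to be frozen along with \<Omega> and \<Gamma>.\<close>
  let ?P1 = "\<lambda>(z :: ((real^'n^'l) \<times> (real^'m^'l)) \<times> (real^'n^'s)) (\<phi> :: real^'m^'s).
      \<forall>v. (1 - \<epsilon>) * (norm (orth_proj (VQ (fst (fst z))) *v v))\<^sup>2
      \<le> (norm (\<phi> *v (orth_proj (VQ (fst (fst z))) *v v)))\<^sup>2"
  let ?P2 = "\<lambda>(z :: (real^'n^'l) \<times> (real^'m^'l)) (\<psi> :: real^'n^'s).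
      \<forall>v. (1 - \<epsilon>) * (norm (orth_proj (VP (snd z)) *v v))\<^sup>2
      \<le> (norm (\<psi> *v (orth_proj (VP (snd z)) *v v)))\<^sup>2"
  let ?P3 = "\<lambda>z (\<psi> :: real^'n^'s).
      (norm (\<psi> ** transpose (E z)))\<^sup>2 \<le> (1 + \<epsilon>) * (norm (transpose (E z)))\<^sup>2"
  let ?P4 = "\<lambda>(z :: _ \<times> (real^'n^'s)) (\<phi> :: real^'m^'s).
      (norm (\<phi> ** (E (fst z) ** transpose (snd z))))\<^sup>2
      \<le> (1 + \<epsilon>) * (norm (E (fst z) ** transpose (snd z)))\<^sup>2"
  have P1: "Measurable.pred borel (\<lambda>z. ?P1 (fst z) (snd z))"
    unfolding borel_prod[symmetric] by measurable
  have P2: "Measurable.pred borel (\<lambda>z. ?P2 (fst z) (snd z))"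
    unfolding borel_prod[symmetric] by measurable
  have P3: "Measurable.pred borel (\<lambda>z. ?P3 (fst z) (snd z))"
    unfolding borel_prod[symmetric] by measurable
  have P4: "Measurable.pred borel (\<lambda>z. ?P4 (fst z) (snd z))"
    unfolding borel_prod[symmetric] by measurable

  have p1: "1 - \<delta> \<le> \<P>(\<omega> in M. ?P1 (?XY \<omega>) (\<Phi> \<omega>))"
    by (rule prob_indep_ge[OF XY assms(6) ind\<Phi> P1])
      (rule OSE_lower_bound[OF assms(13) orth_proj[OF V(1)] V(1,2)])
  have p2: "1 - \<delta> \<le> \<P>(\<omega> in M. ?P2 (?X \<omega>) (\<Psi> \<omega>))"
    by (rule prob_indep_ge[OF X assms(7) ind\<Psi> P2])
      (rule OSE_lower_bound[OF assms(15) orth_proj[OF V(3)] V(3,4)])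
  have p3: "1 - \<delta> \<le> \<P>(\<omega> in M. ?P3 (?X \<omega>) (\<Psi> \<omega>))"
    by (rule prob_indep_ge[OF X assms(7) ind\<Psi> P3]) (intro OSE_matrix[OF assms(16)], simp)
  \<comment> \<open>The columns embedded here lie in dimension m, so m \<le> n keeps the union bound
    within \<delta>.\<close>
  have p4: "1 - \<delta> \<le> \<P>(\<omega> in M. ?P4 (?XY \<omega>) (\<Phi> \<omega>))"
    by (rule prob_indep_ge[OF XY assms(6) ind\<Phi> P4])
      (intro OSE_matrix[OF assms(14)], use assms(2) in simp)
  have Q1: "Measurable.pred M (\<lambda>\<omega>. ?P1 (?XY \<omega>) (\<Phi> \<omega>))" by measurable
  have Q2: "Measurable.pred M (\<lambda>\<omega>. ?P2 (?X \<omega>) (\<Psi> \<omega>))" by measurable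
  have Q3: "Measurable.pred M (\<lambda>\<omega>. ?P3 (?X \<omega>) (\<Psi> \<omega>))" by measurable
  have Q4: "Measurable.pred M (\<lambda>\<omega>. ?P4 (?XY \<omega>) (\<Phi> \<omega>))" by measurable
  have [measurable]: "(\<lambda>\<omega>. orth_proj (VQ (\<Omega> \<omega>))) \<in> borel_measurable M" by measurable
  have [measurable]: "(\<lambda>\<omega>. orth_proj (VP (\<Gamma> \<omega>))) \<in> borel_measurable M" by measurable
  have [measurable]: "(\<lambda>\<omega>. pinv (\<Phi> \<omega> ** orth_proj (VQ (\<Omega> \<omega>)))) \<in> borel_measurable M" by measurable
  have [measurable]: "(\<lambda>\<omega>. pinv (\<Psi> \<omega> ** orth_proj (VP (\<Gamma> \<omega>)))) \<in> borel_measurable M" by measurable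
  have [measurable]: "(\<lambda>\<omega>. single_view A (\<Omega> \<omega>) (\<Gamma> \<omega>) (\<Phi> \<omega>) (\<Psi> \<omega>)) \<in> borel_measurable M"
    unfolding single_view_eq_pinv VQ_def[symmetric] VP_def[symmetric] by measurable
  have [measurable]: "(\<lambda>\<omega>. A - orth_proj (VQ (\<Omega> \<omega>)) ** A ** orth_proj (VP (\<Gamma> \<omega>))) \<in> borel_measurable M"
    by measurable
  have "1 - ((\<delta> + \<delta>) + (\<delta> + \<delta>)) \<le> \<P>(\<omega> in M.
      (?P1 (?XY \<omega>) (\<Phi> \<omega>) \<and> ?P2 (?X \<omega>) (\<Psi> \<omega>)) \<and> (?P3 (?X \<omega>) (\<Psi> \<omega>) \<and> ?P4 (?XY \<omega>) (\<Phi> \<omega>)))"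
    by (rule prob_conj_ge[OF pred_intros_logic(3)[OF Q1 Q2] pred_intros_logic(3)[OF Q3 Q4]
        prob_conj_ge[OF Q1 Q2 p1 p2] prob_conj_ge[OF Q3 Q4 p3 p4]])
  also have "\<dots> \<le> \<P>(\<omega> in M. norm (A - single_view A (\<Omega> \<omega>) (\<Gamma> \<omega>) (\<Phi> \<omega>) (\<Psi> \<omega>))
         \<le> 4.2 * norm (A - orth_proj (VQ (\<Omega> \<omega>)) ** A ** orth_proj (VP (\<Gamma> \<omega>))) \<and>
      4.2 * norm (A - orth_proj (VQ (\<Omega> \<omega>)) ** A ** orth_proj (VP (\<Gamma> \<omega>)))
         \<le> 4.2 * (norm (A - orth_proj (VQ (\<Omega> \<omega>)) ** A) + norm (A - A ** orth_proj (VP (\<Gamma> \<omega>)))))"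
    (is "_ \<le> prob {\<omega> \<in> space M. ?good \<omega>}")
  proof (rule finite_measure_mono)
    have good: "?good \<omega>"
      if *: "?P1 (?XY \<omega>) (\<Phi> \<omega>)" "?P2 (?X \<omega>) (\<Psi> \<omega>)" "?P3 (?X \<omega>) (\<Psi> \<omega>)" "?P4 (?XY \<omega>) (\<Phi> \<omega>)" for \<omega>
    proof
      let ?R = "orth_proj (VQ (\<Omega> \<omega>))" and ?T = "orth_proj (VP (\<Gamma> \<omega>))"
      have "norm (A - single_view A (\<Omega> \<omega>) (\<Gamma> \<omega>) (\<Phi> \<omega>) (\<Psi> \<omega>))
          \<le> (1 + (1 + \<epsilon>) / (1 - \<epsilon>)) * norm (A - ?R ** A ** ?T)"
        unfolding single_view_eq_pinv VQ_def[symmetric] VP_def[symmetric] using * V assms(11,12)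
        by (intro norm_pinv_sandwich_le sketched_projection_orth_proj)
          (simp_all add: E_def norm_transpose)
      \<comment> \<open>Clearing the denominator 1 - \<epsilon> leaves 4.2 \<epsilon> \<le>
        2.2.\<close>
      also have "\<dots> \<le> 4.2 * norm (A - ?R ** A ** ?T)"
        using assms(11,12) by (intro mult_right_mono) (simp_all add: field_simps)
      finally show "norm (A - single_view A (\<Omega> \<omega>) (\<Gamma> \<omega>) (\<Phi> \<omega>) (\<Psi> \<omega>))
          \<le> 4.2 * norm (A - ?R ** A ** ?T)" .
      have "norm (A - ?R ** A ** ?T) \<le> norm (A - ?R ** A) + norm (A - A ** ?T)"
        by (intro norm_residual_le is_orth_proj_sym[OF orth_proj] is_orth_proj_idem[OF orth_proj] V)
      then show "4.2 * norm (A - ?R ** A ** ?T) \<le> 4.2 * (norm (A - ?R ** A) + norm (A - A ** ?T))"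
        by (intro mult_left_mono) simp_all
    qed
    show "{\<omega> \<in> space M. (?P1 (?XY \<omega>) (\<Phi> \<omega>) \<and> ?P2 (?X \<omega>) (\<Psi> \<omega>)) \<and>
        (?P3 (?X \<omega>) (\<Psi> \<omega>) \<and> ?P4 (?XY \<omega>) (\<Phi> \<omega>))} \<subseteq> {\<omega> \<in> space M. ?good \<omega>}"
      by (intro subsetI CollectI; elim CollectE conjE; intro conjI[rotated] good)
    \<comment> \<open>The measure of a non-measurable set is 0 by convention, so the lower bound
      passes to the good event only because that event is measurable.\<close>
    show "{\<omega> \<in> space M. ?good \<omega>} \<in> events" by measurable
  qed
  finally show ?thesis by (simp add: Let_def frobenius_norm_eq_norm VQ_def VP_def)
qed

end
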